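(* Let $\{P_\theta\}$ be a one-parameter exponential family on $\mathcal{X}$ with densities $p_\theta(x)=\exp(\theta T(x)-A(\theta))$ with respect to a base measure $\mu$, let $\theta_0$ be an interior point of the natural parameter space, and assume $\operatorname{Var}_\theta(T(X))>0$. Let $\hat T_n$ be an estimator with $\hat T_n\overset{p}\to t_0:=\mathbb{E}_{\theta_0}[T(X)]$, constructed independently of an i.i.d. sample $X_1,\dots,X_n\sim P_{\theta_0}$. Let $\varepsilon>0$ and let $\hat\theta_n=H(\bar Z_n,\hat T_n)$ be the $\varepsilon$-differentially private two-stage estimator (defined in the context). Define $\delta_\varepsilon^2=\frac{e^\varepsilon}{(e^\varepsilon-1)^2}$ and $J_{\theta_0}=\mathbb{E}_{\theta_0}[|T(X)-\mathbb{E}_{\theta_0}[T(X)]|]$. Then there exist random variables $G_n=\Psi(\hat T_n,\theta_0)\in[0,1]$, $\mathcal{E}_{n,1}$ and $\mathcal{E}_{n,2}$ such that under $P_{\theta_0}$, $$\sqrt n(\hat\theta_n-\theta_0)=2J_{\theta_0}^{-1}(\mathcal{E}_{n,1}+\mathcal{E}_{n,2})+o_P(1),$$ where $$\left(\mathcal{E}_{n,1},\ \frac{1}{\sqrt{G_n(1-G_n)}}\mathcal{E}_{n,2}\right)\overset{d}\to\mathcal{N}\big(0,\operatorname{diag}(\delta_\varepsilon^2,1)\big).$$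
   Context: $A(\theta)=\log\int e^{\theta T(x)}d\mu(x)$; the natural parameter space is $\{\theta:A(\theta)<\infty\}$. $\Psi(t,\theta)=P_\theta(T(X)\ge t)$ and $H(p,t)=\inf\{\theta\in\mathbb{R}:\Psi(t,\theta)\ge p\}$ (over $\theta$ in the natural parameter space; the value is $-\infty$ or $+\infty$ for $p$ below or above the range of $\theta\mapsto\Psi(t,\theta)$). Given $\hat T_n$ (computed from a first, separate half of a total sample of size $2n$) and the second-half sample $X_1,\dots,X_n$, set $V_i=\mathbf{1}\{T(X_i)\ge\hat T_n\}$ and, independently across $i$, $$Z_i=\frac{e^\varepsilon+1}{e^\varepsilon-1}\Big[\tilde V_i-\frac{1}{e^\varepsilon+1}\Big],\qquad \tilde V_i=\begin{cases}V_i&\text{w.p. }\frac{e^\varepsilon}{e^\varepsilon+1}\\1-V_i&\text{w.p. }\frac{1}{e^\varepsilon+1},\end{cases}$$ and $\bar Z_n=\frac1n\sum_{i=1}^nZ_i$. *)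

theory Defs
  imports "HOL-Probability.Probability"
begin

text \<open>One-parameter exponential families with statistic \<open>T\<close> and base measure \<open>\<mu>\<close>.\<close>

definition log_partition :: "'b measure \<Rightarrow> ('b \<Rightarrow> real) \<Rightarrow> real \<Rightarrow> ereal" where
  "log_partition \<mu> T \<theta> =
    (let I = (\<integral>\<^sup>+x. ennreal (exp (\<theta> * T x)) \<partial>\<mu>)
     in if I = 0 then - \<infinity> else if I = \<infinity> then \<infinity> else ereal (ln (enn2real I)))"

definition natural_space :: "'b measure \<Rightarrow> ('b \<Rightarrow> real) \<Rightarrow> real set" where
  "natural_space \<mu> T = {\<theta>. log_partition \<mu> T \<theta> < \<infinity>}"

text \<open>Meaningful for parameters in the natural parameter space only.\<close>

definition exp_family :: "'b measure \<Rightarrow> ('b \<Rightarrow> real) \<Rightarrow> real \<Rightarrow> 'b measure" where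
  "exp_family \<mu> T \<theta> =
    density \<mu> (\<lambda>x. ennreal (exp (\<theta> * T x - real_of_ereal (log_partition \<mu> T \<theta>))))"

definition mean_stat :: "'b measure \<Rightarrow> ('b \<Rightarrow> real) \<Rightarrow> real \<Rightarrow> real" where
  "mean_stat \<mu> T \<theta> = (\<integral>x. T x \<partial>exp_family \<mu> T \<theta>)"

definition var_stat :: "'b measure \<Rightarrow> ('b \<Rightarrow> real) \<Rightarrow> real \<Rightarrow> real" where
  "var_stat \<mu> T \<theta> = (\<integral>x. (T x - mean_stat \<mu> T \<theta>)\<^sup>2 \<partial>exp_family \<mu> T \<theta>)"

definition abs_dev_stat :: "'b measure \<Rightarrow> ('b \<Rightarrow> real) \<Rightarrow> real \<Rightarrow> real" where
  "abs_dev_stat \<mu> T \<theta> = (\<integral>x. \<bar>T x - mean_stat \<mu> T \<theta>\<bar> \<partial>exp_family \<mu> T \<theta>)"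

definition tail_prob :: "'b measure \<Rightarrow> ('b \<Rightarrow> real) \<Rightarrow> real \<Rightarrow> real \<Rightarrow> real" where
  "tail_prob \<mu> T t \<theta> = measure (exp_family \<mu> T \<theta>) {x \<in> space \<mu>. t \<le> T x}"

text \<open>The inverse of \<open>\<theta> \<mapsto> tail_prob \<mu> T t \<theta>\<close>. For \<open>p\<close> below its range the value is
  \<open>-\<infinity>\<close> by convention (the bare infimum would be the left end of the natural parameter
  space, which may be finite); for \<open>p\<close> above its range the infimum of the empty set is
  \<open>\<infinity>\<close>.\<close>

definition tail_inverse :: "'b measure \<Rightarrow> ('b \<Rightarrow> real) \<Rightarrow> real \<Rightarrow> real \<Rightarrow> ereal" where
  "tail_inverse \<mu> T p t =
    (if \<forall>\<theta>\<in>natural_space \<mu> T. p < tail_prob \<mu> T t \<theta> then - \<infinity>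
     else Inf (ereal ` {\<theta> \<in> natural_space \<mu> T. p \<le> tail_prob \<mu> T t \<theta>}))"

text \<open>Randomized response: the bit \<open>v\<close> is reported truthfully iff \<open>keep\<close>, where the
  coin \<open>keep\<close> is to have success probability \<open>keep_prob \<epsilon>\<close>.\<close>

definition keep_prob :: "real \<Rightarrow> real" where
  "keep_prob \<epsilon> = exp \<epsilon> / (exp \<epsilon> + 1)"

definition rand_response :: "bool \<Rightarrow> real \<Rightarrow> real" where
  "rand_response keep v = (if keep then v else 1 - v)"

definition debias :: "real \<Rightarrow> real \<Rightarrow> real" where
  "debias \<epsilon> w = (exp \<epsilon> + 1) / (exp \<epsilon> - 1) * (w - 1 / (exp \<epsilon> + 1))"

definition private_mean ::
    "('b \<Rightarrow> real) \<Rightarrow> real \<Rightarrow> nat \<Rightarrow> real \<Rightarrow> (nat \<Rightarrow> 'b) \<Rightarrow> (nat \<Rightarrow> bool) \<Rightarrow> real" where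
  "private_mean T \<epsilon> n t x keep =
    (\<Sum>i<n. debias \<epsilon> (rand_response (keep i) (of_bool (T (x i) \<ge> t)))) / real n"

definition two_stage_estimator ::
    "'b measure \<Rightarrow> ('b \<Rightarrow> real) \<Rightarrow> real \<Rightarrow> nat \<Rightarrow> real \<Rightarrow> (nat \<Rightarrow> 'b) \<Rightarrow> (nat \<Rightarrow> bool) \<Rightarrow> ereal" where
  "two_stage_estimator \<mu> T \<epsilon> n t x keep = tail_inverse \<mu> T (private_mean T \<epsilon> n t x keep) t"

text \<open>The library's \<open>indep_var\<close> requires both variables to have the same type.\<close>

definition indep_var2 ::
    "'a measure \<Rightarrow> 'c measure \<Rightarrow> ('a \<Rightarrow> 'c) \<Rightarrow> 'd measure \<Rightarrow> ('a \<Rightarrow> 'd) \<Rightarrow> bool" where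
  "indep_var2 M S X N Y \<longleftrightarrow> X \<in> M \<rightarrow>\<^sub>M S \<and> Y \<in> M \<rightarrow>\<^sub>M N \<and>
    prob_space.indep_set M {X -` A \<inter> space M | A. A \<in> sets S} {Y -` B \<inter> space M | B. B \<in> sets N}"

text \<open>Modes of convergence along a sequence of probability spaces. The remainder in
  \<open>o_P(1)\<close> may take infinite values, as the estimator above can.\<close>

definition small_in_prob :: "(nat \<Rightarrow> 'a measure) \<Rightarrow> (nat \<Rightarrow> 'a \<Rightarrow> ereal) \<Rightarrow> bool" where
  "small_in_prob M R \<longleftrightarrow>
    (\<forall>n. R n \<in> borel_measurable (M n)) \<and>
    (\<forall>\<eta>::real. \<eta> > 0 \<longrightarrow>
      (\<lambda>n. measure (M n) {\<omega> \<in> space (M n). ereal \<eta> < \<bar>R n \<omega>\<bar>}) \<longlonglongrightarrow> 0)"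

definition conv_in_prob :: "(nat \<Rightarrow> 'a measure) \<Rightarrow> (nat \<Rightarrow> 'a \<Rightarrow> real) \<Rightarrow> real \<Rightarrow> bool" where
  "conv_in_prob M Y c \<longleftrightarrow> small_in_prob M (\<lambda>n \<omega>. ereal (Y n \<omega> - c))"

definition conv_in_distr ::
    "(nat \<Rightarrow> 'a measure) \<Rightarrow> (nat \<Rightarrow> 'a \<Rightarrow> 'c::topological_space) \<Rightarrow> 'c measure \<Rightarrow> bool" where
  "conv_in_distr M Y N \<longleftrightarrow>
    (\<forall>n. Y n \<in> borel_measurable (M n)) \<and>
    (\<forall>f::'c \<Rightarrow> real. continuous_on UNIV f \<longrightarrow> bounded (range f) \<longrightarrow>
      (\<lambda>n. \<integral>\<omega>. f (Y n \<omega>) \<partial>M n) \<longlonglongrightarrow> (\<integral>y. f y \<partial>N))"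

text \<open>The multivariate normal law; the covariance matrix must be positive definite.\<close>

definition mv_normal :: "real ^ 'n \<Rightarrow> real ^ 'n ^ 'n \<Rightarrow> (real ^ 'n) measure" where
  "mv_normal m S = density lborel (\<lambda>x. ennreal (
     exp (- ((x - m) \<bullet> (matrix_inv S *v (x - m))) / 2) / sqrt ((2 * pi) ^ CARD('n) * det S)))"

definition diag_matrix :: "real ^ 'n \<Rightarrow> real ^ 'n ^ 'n" where
  "diag_matrix d = (\<chi> i j. if i = j then d $ i else 0)"

end

theory Submission
  imports Defs
begin

text \<open>
  Write \<open>t\<^sub>0\<close> for the mean of \<open>T\<close> under \<open>\<theta>\<^sub>0\<close>, \<open>G(t) = P(T \<ge> t)\<close> under \<open>\<theta>\<^sub>0\<close>, and \<open>t\<close> for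
  the first-stage value \<open>That n\<close>. The proof separates a deterministic statement about
  the inverse of the tail probability from a central limit theorem for the private mean.

  Randomness. After debiasing, a report is \<open>Z\<^sub>i = V\<^sub>i + (2 V\<^sub>i - 1) \<xi>\<^sub>i\<close>, where \<open>\<xi>\<^sub>i\<close> depends on
  the coin only, has mean zero and variance \<open>\<delta>\<^sup>2\<close> (\<open>debias_rand_response\<close>,
  \<open>response_noise_moments\<close>). Hence \<open>sqrt n (Zbar - G(t))\<close> is the sum of the privacy term
  \<open>E1\<close>, the normalized sum of the \<open>(2 V\<^sub>i - 1) \<xi>\<^sub>i\<close>, and the sampling term \<open>E2\<close>, the normalized
  sum of the \<open>V\<^sub>i - G(t)\<close>. For fixed \<open>t\<close> the summands are bounded, i.i.d., centred and
  uncorrelated, because \<open>\<xi>\<^sub>i\<close> is independent of \<open>V\<^sub>i\<close>; their variances are \<open>\<delta>\<^sup>2\<close> and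
  \<open>G(t) (1 - G(t))\<close>. After dividing \<open>E2\<close> by \<open>sqrt (G(t) (1 - G(t)))\<close> the covariance matrix no longer
  depends on \<open>t\<close>, and a Taylor expansion bounds the distance to the Gaussian characteristic
  function uniformly over \<open>t\<close> near \<open>t\<^sub>0\<close>. As the first stage is independent of the sample, its law can be
  integrated out (\<open>mixture_clt_char\<close>), and Levy's continuity theorem in the plane
  (\<open>levy_continuity_euclidean\<close>) gives joint convergence in distribution. The uniform bound needs
  \<open>G(t) (1 - G(t))\<close> to stay away from zero near \<open>t\<^sub>0\<close>; this is a Cauchy-Schwarz argument
  (\<open>slope_variance_bound\<close>).

  Inversion. Uniformly in \<open>t\<close>, \<open>P\<^sub>\<theta>(T \<ge> t) = G(t) + h c(t) + O(h\<^sup>2)\<close> for \<open>\<theta> = \<theta>\<^sub>0 + h\<close>, where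
  \<open>c(t)\<close> is the covariance of \<open>T\<close> with the indicator of \<open>T \<ge> t\<close> (\<open>tail_expansion\<close>). Centring gives
  \<open>c(t\<^sub>0) = J / 2\<close>, and \<open>c\<close> differs from this by at most \<open>\<bar>t - t\<^sub>0\<bar>\<close>. Since the tail probability is
  monotone in \<open>\<theta>\<close>, comparing it with \<open>p\<close> at the two points
  \<open>\<theta>\<^sub>0 + (2 S / J \<plusminus> \<eta>) / sqrt n\<close>, with \<open>S = sqrt n (p - G(t))\<close>, traps its inverse at \<open>p\<close>
  (\<open>tail_inverse_expansion\<close>). The remainder is therefore small as soon as \<open>S\<close> is bounded
  and \<open>t\<close> is close to \<open>t\<^sub>0\<close>. The first happens with high probability because weakly convergent
  sequences are tight (\<open>conv_in_distr_tight\<close>), the second because the first stage is consistent.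
\<close>

section \<open>Gaussian measures on Euclidean spaces\<close>

lemma integral_gauss_line:
  fixes u v :: real
  assumes v: "0 < v"
  shows "integrable lborel (\<lambda>s. iexp (u * s) * complex_of_real (exp (- s\<^sup>2 / (2 * v))))" (is ?I)
    and "(\<integral>s. iexp (u * s) * complex_of_real (exp (- s\<^sup>2 / (2 * v))) \<partial>lborel)
      = complex_of_real (sqrt (2 * pi * v) * exp (- (v * u\<^sup>2) / 2))" (is ?E)
proof -
  have dens: "sqrt (2 * pi * v) * normal_density 0 (sqrt v) s = exp (- s\<^sup>2 / (2 * v))" for s
    using v by (simp add: normal_density_def)
  have int_dens: "integrable lborel (normal_density 0 (sqrt v))"
    using v by (simp add: integrable_normal_density)
  have int: "integrable lborel (\<lambda>s. exp (- s\<^sup>2 / (2 * v)))"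
    unfolding dens[symmetric] using int_dens by (intro integrable_mult_right)
  show ?I
    by (rule Bochner_Integration.integrable_bound[OF int]) (auto simp: norm_mult)
  have sv: "sqrt v \<noteq> 0" using v by simp
  have "(\<integral>s. iexp (u * s) * complex_of_real (exp (- s\<^sup>2 / (2 * v))) \<partial>lborel)
      = \<bar>sqrt v\<bar> *\<^sub>R (\<integral>s. iexp (u * (0 + sqrt v * s)) *
          complex_of_real (exp (- (0 + sqrt v * s)\<^sup>2 / (2 * v))) \<partial>lborel)"
    by (rule lborel_integral_real_affine[OF sv])
  also have "(\<integral>s. iexp (u * (0 + sqrt v * s)) * complex_of_real (exp (- (0 + sqrt v * s)\<^sup>2 / (2 * v))) \<partial>lborel)
      = (\<integral>s. sqrt (2 * pi) *\<^sub>R (std_normal_density s *\<^sub>R iexp ((u * sqrt v) * s)) \<partial>lborel)"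
    using v by (intro Bochner_Integration.integral_cong)
      (auto simp: std_normal_density_def power_mult_distrib scaleR_conv_of_real mult_ac)
  also have "\<dots> = sqrt (2 * pi) *\<^sub>R (\<integral>s. std_normal_density s *\<^sub>R iexp ((u * sqrt v) * s) \<partial>lborel)"
    by (rule integral_scaleR_right)
  also have "(\<integral>s. std_normal_density s *\<^sub>R iexp ((u * sqrt v) * s) \<partial>lborel)
      = char std_normal_distribution (u * sqrt v)"
    unfolding char_def by (rule integral_density[symmetric]) auto
  finally show ?E
    using v by (simp add: char_std_normal_distribution power_mult_distrib scaleR_conv_of_real
        real_sqrt_mult mult_ac)
qed

text \<open>Lebesgue measure on a Euclidean space is a product of copies of the one on the line, so a
  product of functions of the coordinates integrates factor by factor.\<close>

lemma integral_lborel_prod_Basis: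
  fixes f :: "'c::euclidean_space \<Rightarrow> real \<Rightarrow> 'd::{real_normed_field,banach,second_countable_topology}"
  assumes f: "\<And>b. b \<in> Basis \<Longrightarrow> integrable lborel (f b)"
  shows "integrable lborel (\<lambda>x::'c. \<Prod>b\<in>Basis. f b (x \<bullet> b))" (is ?I)
    and "integral\<^sup>L lborel (\<lambda>x::'c. \<Prod>b\<in>Basis. f b (x \<bullet> b)) = (\<Prod>b\<in>Basis. integral\<^sup>L lborel (f b))" (is ?E)
proof -
  interpret product_sigma_finite "\<lambda>_::'c. lborel :: real measure" by standard
  have [measurable]: "f b \<in> borel_measurable borel" if "b \<in> Basis" for b
    using borel_measurable_integrable[OF f[OF that]] by simp
  have prod_meas: "(\<lambda>x::'c. \<Prod>b\<in>Basis. f b (x \<bullet> b)) \<in> borel_measurable borel"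
    by (intro borel_measurable_prod) measurable
  have eq: "(\<Prod>b\<in>Basis. f b ((\<Sum>b'\<in>Basis. g b' *\<^sub>R b') \<bullet> b)) = (\<Prod>b\<in>Basis. f b (g b))" for g
    by (intro prod.cong refl) simp
  show ?I
    by (subst lborel_eq, subst integrable_distr_eq)
      (use prod_meas f in \<open>auto simp: eq intro!: product_integrable_prod\<close>)
  show ?E
    by (subst lborel_eq, subst integral_distr)
      (use prod_meas f in \<open>auto simp: eq intro!: product_integral_prod\<close>)
qed

lemma integral_gauss_weighted:
  fixes u :: "'c::euclidean_space" and v :: "'c \<Rightarrow> real"
  assumes v: "\<And>b. b \<in> Basis \<Longrightarrow> 0 < v b"
  shows "integrable lborel
      (\<lambda>x. iexp (u \<bullet> x) * complex_of_real (exp (- (\<Sum>b\<in>Basis. (x \<bullet> b)\<^sup>2 / v b) / 2)))" (is ?I)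
    and "(\<integral>x. iexp (u \<bullet> x) * complex_of_real (exp (- (\<Sum>b\<in>Basis. (x \<bullet> b)\<^sup>2 / v b) / 2)) \<partial>lborel)
      = complex_of_real ((\<Prod>b\<in>Basis. sqrt (2 * pi * v b)) * exp (- (\<Sum>b\<in>Basis. v b * (u \<bullet> b)\<^sup>2) / 2))"
      (is ?E)
proof -
  have split: "iexp (u \<bullet> x) * complex_of_real (exp (- (\<Sum>b\<in>Basis. (x \<bullet> b)\<^sup>2 / v b) / 2))
     = (\<Prod>b\<in>Basis. iexp ((u \<bullet> b) * (x \<bullet> b)) * complex_of_real (exp (- (x \<bullet> b)\<^sup>2 / (2 * v b))))" for x
  proof -
    have "iexp (u \<bullet> x) = (\<Prod>b\<in>Basis. iexp ((u \<bullet> b) * (x \<bullet> b)))"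
      unfolding euclidean_inner[of u x] of_real_sum sum_distrib_left by (rule exp_sum) simp
    moreover have "exp (- (\<Sum>b\<in>Basis. (x \<bullet> b)\<^sup>2 / v b) / 2) = (\<Prod>b\<in>Basis. exp (- (x \<bullet> b)\<^sup>2 / (2 * v b)))"
      by (simp add: exp_sum[symmetric] sum_negf sum_divide_distrib mult_ac)
    ultimately show ?thesis by (simp add: prod.distrib)
  qed
  note line = integral_gauss_line[OF v]
  note product = integral_lborel_prod_Basis
    [of "\<lambda>b s. iexp ((u \<bullet> b) * s) * complex_of_real (exp (- s\<^sup>2 / (2 * v b)))", OF line(1)]
  show ?I unfolding split by (rule product(1))
  have "(\<Prod>b\<in>Basis. sqrt (2 * pi * v b) * exp (- (v b * (u \<bullet> b)\<^sup>2) / 2))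
     = (\<Prod>b\<in>Basis. sqrt (2 * pi * v b)) * exp (- (\<Sum>b\<in>Basis. v b * (u \<bullet> b)\<^sup>2) / 2)"
    by (simp add: prod.distrib exp_sum[symmetric] sum_negf sum_divide_distrib)
  note prod_values = arg_cong[OF this, of complex_of_real, unfolded of_real_prod]
  show ?E unfolding split prod_values[symmetric]
    by (subst product(2), assumption) (intro prod.cong refl line(2))
qed

text \<open>The centred normal law with independent coordinates, \<open>v b\<close> being the variance of the coordinate
  in direction \<open>b\<close>.\<close>

definition gauss_measure :: "('c::euclidean_space \<Rightarrow> real) \<Rightarrow> 'c measure" where
  "gauss_measure v = density lborel (\<lambda>x.
     ennreal (exp (- (\<Sum>b\<in>Basis. (x \<bullet> b)\<^sup>2 / v b) / 2) / (\<Prod>b\<in>Basis. sqrt (2 * pi * v b))))"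

lemma sets_gauss_measure [simp, measurable_cong]: "sets (gauss_measure v) = sets borel"
  by (simp add: gauss_measure_def)

lemma space_gauss_measure [simp]: "space (gauss_measure v) = UNIV"
  by (simp add: gauss_measure_def)

lemma integral_iexp_gauss_measure:
  fixes u :: "'c::euclidean_space"
  assumes v: "\<And>b. b \<in> Basis \<Longrightarrow> 0 < v b"
  shows "(\<integral>x. iexp (u \<bullet> x) \<partial>gauss_measure v)
    = complex_of_real (exp (- (\<Sum>b\<in>Basis. v b * (u \<bullet> b)\<^sup>2) / 2))"
proof -
  let ?Z = "\<Prod>b\<in>(Basis::'c set). sqrt (2 * pi * v b)"
  have Z: "0 < ?Z" using v by (intro prod_pos) simp
  have "(\<integral>x. iexp (u \<bullet> x) \<partial>gauss_measure v)
      = (\<integral>x. (exp (- (\<Sum>b\<in>Basis. (x \<bullet> b)\<^sup>2 / v b) / 2) / ?Z) *\<^sub>R iexp (u \<bullet> x) \<partial>lborel)"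
    unfolding gauss_measure_def using Z by (intro integral_density) (auto intro!: divide_nonneg_pos)
  also have "\<dots> = (\<integral>x. (iexp (u \<bullet> x) * complex_of_real (exp (- (\<Sum>b\<in>Basis. (x \<bullet> b)\<^sup>2 / v b) / 2))) / ?Z \<partial>lborel)"
    by (intro Bochner_Integration.integral_cong) (auto simp: scaleR_conv_of_real)
  also have "\<dots> = complex_of_real (?Z * exp (- (\<Sum>b\<in>Basis. v b * (u \<bullet> b)\<^sup>2) / 2)) / ?Z"
    by (subst integral_divide_zero, subst integral_gauss_weighted(2)[OF v]) auto
  also have "\<dots> = complex_of_real (exp (- (\<Sum>b\<in>Basis. v b * (u \<bullet> b)\<^sup>2) / 2))"
  proof -
    have cancel: "complex_of_real (z * e) / z = complex_of_real e" if "0 < z" for z e :: real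
      using that by simp
    show ?thesis by (rule cancel[OF Z])
  qed
  finally show ?thesis .
qed

lemma prob_space_gauss_measure:
  fixes v :: "'c::euclidean_space \<Rightarrow> real"
  assumes v: "\<And>b. b \<in> Basis \<Longrightarrow> 0 < v b"
  shows "prob_space (gauss_measure v)"
proof -
  let ?Z = "\<Prod>b\<in>(Basis::'c set). sqrt (2 * pi * v b)"
  let ?g = "\<lambda>x::'c. exp (- (\<Sum>b\<in>Basis. (x \<bullet> b)\<^sup>2 / v b) / 2)"
  have Z: "0 < ?Z" using v by (intro prod_pos) simp
  have cint: "integrable lborel (\<lambda>x. complex_of_real (?g x))"
    using integral_gauss_weighted(1)[OF v, where u=0] by simp
  have int: "integrable lborel ?g"
    using integrable_Re[OF cint] by simp
  have "complex_of_real (integral\<^sup>L lborel ?g) = ?Z"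
    using integral_gauss_weighted(2)[OF v, where u=0] by simp
  then have val: "integral\<^sup>L lborel ?g = ?Z" using of_real_eq_iff by blast
  have "emeasure (gauss_measure v) UNIV = (\<integral>\<^sup>+x. ennreal (?g x / ?Z) \<partial>lborel)"
    unfolding gauss_measure_def by (subst emeasure_density) auto
  also have "\<dots> = ennreal (\<integral>x. ?g x / ?Z \<partial>lborel)"
    using int Z by (intro nn_integral_eq_integral) (auto intro!: AE_I2 divide_nonneg_pos)
  also have "(\<integral>x. ?g x / ?Z \<partial>lborel) = ?Z / ?Z" by (simp only: integral_divide_zero val)
  also have "ennreal (?Z / ?Z) = 1" using Z divide_self[of ?Z] by (simp only: ennreal_1 less_imp_neq[symmetric] not_False_eq_True)
  finally show ?thesis by (intro prob_spaceI) simp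
qed

abbreviation std_gauss :: "'c::euclidean_space measure" where
  "std_gauss \<equiv> gauss_measure (\<lambda>_. 1)"

lemma power2_norm_Basis: "(norm x)\<^sup>2 = (\<Sum>b\<in>Basis. (x \<bullet> b)\<^sup>2)" for x :: "'c::euclidean_space"
  unfolding power2_norm_eq_inner euclidean_inner[of x x] by (simp add: power2_eq_square)

lemma integral_iexp_std_gauss:
  "(\<integral>x. iexp (u \<bullet> x) \<partial>(std_gauss :: 'c::euclidean_space measure)) = complex_of_real (exp (- (norm u)\<^sup>2 / 2))"
  using integral_iexp_gauss_measure[of "\<lambda>_. 1" u] by (simp add: power2_norm_Basis)

lemma Basis_vec_eq_range: "(Basis :: (real ^ 'n) set) = range (\<lambda>i. axis i 1)"
  by (auto simp: Basis_vec_def)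

lemma inj_axis_1: "inj (\<lambda>i::'n::finite. axis i (1::real))"
  by (auto simp: inj_on_def axis_eq_axis)

lemma mv_normal_diag_eq_gauss:
  fixes d :: "real ^ 'n"
  assumes d: "\<And>i. d $ i > 0"
  shows "mv_normal 0 (diag_matrix d) = gauss_measure (\<lambda>b. d \<bullet> b)"
proof -
  let ?e = "\<chi> i. 1 / d $ i"
  have mult: "diag_matrix a ** diag_matrix b = mat 1" if ab: "\<And>i. a $ i * b $ i = 1" for a b :: "real ^ 'n"
  proof -
    have "(diag_matrix a ** diag_matrix b) $ i $ j = mat 1 $ i $ j" for i j
    proof -
      have "(diag_matrix a ** diag_matrix b) $ i $ j
          = (\<Sum>k\<in>UNIV. if k = i then (if i = j then a $ i * b $ i else 0) else 0)"
        unfolding matrix_matrix_mult_def diag_matrix_def vec_lambda_beta by (intro sum.cong) auto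
      then show ?thesis by (simp add: mat_def ab)
    qed
    then show ?thesis by (simp add: vec_eq_iff)
  qed
  have inv: "matrix_inv (diag_matrix d) = diag_matrix ?e"
    unfolding matrix_inv_def
  proof (rule some_equality)
    have "d $ i * ?e $ i = 1" "?e $ i * d $ i = 1" for i
      using d[of i] by simp_all
    then show inverse: "diag_matrix d ** diag_matrix ?e = mat 1 \<and> diag_matrix ?e ** diag_matrix d = mat 1"
      by (intro conjI mult)
    fix B assume "diag_matrix d ** B = mat 1 \<and> B ** diag_matrix d = mat 1"
    then show "B = diag_matrix ?e"
      using inverse by (metis matrix_mul_assoc matrix_mul_lid matrix_mul_rid)
  qed
  have apply_e: "(diag_matrix ?e *v x) $ i = x $ i / d $ i" for x :: "real ^ 'n" and i
  proof -
    have "(diag_matrix ?e *v x) $ i = (\<Sum>k\<in>UNIV. if k = i then x $ i / d $ i else 0)"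
      unfolding matrix_vector_mult_def diag_matrix_def vec_lambda_beta by (intro sum.cong) auto
    then show ?thesis by simp
  qed
  have quad: "x \<bullet> (diag_matrix ?e *v x) = (\<Sum>b\<in>Basis. (x \<bullet> b)\<^sup>2 / (d \<bullet> b))" for x :: "real ^ 'n"
    unfolding Basis_vec_eq_range sum.reindex[OF inj_axis_1] inner_vec_def[of x "_ *v _"]
    by (simp add: apply_e inner_axis power2_eq_square)
  have det: "det (diag_matrix d) = (\<Prod>i\<in>UNIV. d $ i)"
    by (subst det_diagonal) (auto simp: diag_matrix_def)
  have norm_const: "sqrt ((2 * pi) ^ CARD('n) * det (diag_matrix d)) = (\<Prod>b\<in>Basis. sqrt (2 * pi * (d \<bullet> b)))"
    unfolding det Basis_vec_eq_range prod.reindex[OF inj_axis_1]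
  proof (intro real_sqrt_unique)
    have "(\<Prod>i\<in>UNIV. sqrt (2 * pi * d $ i))\<^sup>2 = (\<Prod>i\<in>UNIV. 2 * pi * d $ i)"
      unfolding prod_power_distrib using d by (intro prod.cong refl real_sqrt_pow2) (simp add: less_imp_le)
    then show "(prod ((\<lambda>b. sqrt (2 * pi * (d \<bullet> b))) \<circ> (\<lambda>i. axis i 1)) UNIV)\<^sup>2
        = (2 * pi) ^ CARD('n) * (\<Prod>i\<in>UNIV. d $ i)"
      by (simp add: o_def inner_axis prod.distrib)
    show "0 \<le> prod ((\<lambda>b. sqrt (2 * pi * (d \<bullet> b))) \<circ> (\<lambda>i. axis i 1)) UNIV"
      by (intro prod_nonneg) (use d in \<open>auto simp: inner_axis less_imp_le\<close>)
  qed
  show ?thesis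
    unfolding mv_normal_def gauss_measure_def diff_zero inv quad norm_const ..
qed

lemma vector_2_eq_axis: "(vector [a, b] :: real ^ 2) = a *\<^sub>R axis 1 1 + b *\<^sub>R axis 2 1"
  by (simp add: vec_eq_iff forall_2 vector_2 axis_def)

section \<open>Levy's continuity theorem in Euclidean spaces\<close>

text \<open>The Gaussian bump is itself a characteristic function, that of a standard normal vector. By
  Fubini its expectation under any law is an average of values of the characteristic function of that
  law. This is what turns convergence of characteristic functions into convergence of expectations.\<close>

lemma gauss_kernel_expectation:
  fixes Y :: "'a \<Rightarrow> 'c::euclidean_space"
  assumes M: "prob_space M" and Y [measurable]: "Y \<in> borel_measurable M"
  shows "complex_of_real (\<integral>\<omega>. exp (- (norm (s *\<^sub>R (Y \<omega> - c)))\<^sup>2 / 2) \<partial>M)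
    = (\<integral>x. (\<integral>\<omega>. iexp ((s *\<^sub>R x) \<bullet> Y \<omega>) \<partial>M) * iexp (- ((s *\<^sub>R x) \<bullet> c)) \<partial>std_gauss)"
proof -
  interpret M: prob_space M by fact
  interpret G: prob_space "std_gauss :: 'c measure" by (intro prob_space_gauss_measure) simp
  interpret MG: pair_prob_space M "std_gauss :: 'c measure" ..
  have ker: "complex_of_real (exp (- (norm (s *\<^sub>R (Y \<omega> - c)))\<^sup>2 / 2))
      = (\<integral>x. iexp ((s *\<^sub>R x) \<bullet> Y \<omega>) * iexp (- ((s *\<^sub>R x) \<bullet> c)) \<partial>std_gauss)" for \<omega>
    unfolding integral_iexp_std_gauss[symmetric] exp_add[symmetric]
    by (intro Bochner_Integration.integral_cong)
       (auto simp: inner_simps inner_commute algebra_simps)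
  have int: "integrable (M \<Otimes>\<^sub>M std_gauss)
      (case_prod (\<lambda>\<omega> x. iexp ((s *\<^sub>R x) \<bullet> Y \<omega>) * iexp (- ((s *\<^sub>R x) \<bullet> c))))"
    by (rule MG.integrable_const_bound[where B=1]) (auto simp: norm_mult)
  have "complex_of_real (\<integral>\<omega>. exp (- (norm (s *\<^sub>R (Y \<omega> - c)))\<^sup>2 / 2) \<partial>M)
      = (\<integral>\<omega>. (\<integral>x. iexp ((s *\<^sub>R x) \<bullet> Y \<omega>) * iexp (- ((s *\<^sub>R x) \<bullet> c)) \<partial>std_gauss) \<partial>M)"
    unfolding ker[symmetric] by (rule integral_complex_of_real[symmetric])
  also have "\<dots> = (\<integral>x. (\<integral>\<omega>. iexp ((s *\<^sub>R x) \<bullet> Y \<omega>) * iexp (- ((s *\<^sub>R x) \<bullet> c)) \<partial>M) \<partial>std_gauss)"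
    by (rule MG.Fubini_integral[OF int, symmetric])
  also have "\<dots> = (\<integral>x. (\<integral>\<omega>. iexp ((s *\<^sub>R x) \<bullet> Y \<omega>) \<partial>M) * iexp (- ((s *\<^sub>R x) \<bullet> c)) \<partial>std_gauss)"
    by (simp only: integral_mult_left_zero)
  finally show ?thesis .
qed

lemma lborel_integral_affine:
  fixes f :: "'c::euclidean_space \<Rightarrow> real"
  assumes c: "c \<noteq> 0" and f [measurable]: "f \<in> borel_measurable borel"
  shows "(\<integral>x. f x \<partial>lborel) = (\<integral>x. (\<bar>c\<bar> ^ DIM('c)) *\<^sub>R f (t + c *\<^sub>R x) \<partial>lborel)"
proof -
  have "(\<integral>x. f x \<partial>lborel) = (\<integral>x. (\<bar>c\<bar> ^ DIM('c)) *\<^sub>R f x \<partial>distr lborel borel (\<lambda>x. t + c *\<^sub>R x))"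
    by (subst lborel_affine[OF c, of t], rule integral_density) auto
  also have "\<dots> = (\<integral>x. (\<bar>c\<bar> ^ DIM('c)) *\<^sub>R f (t + c *\<^sub>R x) \<partial>lborel)"
    by (rule integral_distr) auto
  finally show ?thesis .
qed

text \<open>Convolution of \<open>f\<close> with a centred normal law of standard deviation \<open>1 / s\<close> in each coordinate.\<close>

definition gauss_smooth :: "real \<Rightarrow> ('c::euclidean_space \<Rightarrow> real) \<Rightarrow> 'c \<Rightarrow> real" where
  "gauss_smooth s f y = (\<integral>z. f (y + z /\<^sub>R s) \<partial>std_gauss)"

text \<open>After the substitution \<open>c = y + z / s\<close>, a smoothed function is a superposition of
  Gaussian bumps.\<close>

lemma gauss_smooth_eq_kernel_average:
  fixes f :: "'c::euclidean_space \<Rightarrow> real"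
  assumes s: "s > 0" and f [measurable]: "f \<in> borel_measurable borel"
  shows "gauss_smooth s f y = s ^ DIM('c) / sqrt (2 * pi) ^ DIM('c) *
    (\<integral>c. f c * exp (- (norm (s *\<^sub>R (y - c)))\<^sup>2 / 2) \<partial>lborel)"
proof -
  let ?Z = "sqrt (2 * pi) ^ DIM('c)"
  have std: "(std_gauss :: 'c measure) = density lborel (\<lambda>x. ennreal (exp (- (norm x)\<^sup>2 / 2) / ?Z))"
    unfolding gauss_measure_def power2_norm_Basis by simp
  have cancel: "s *\<^sub>R (y - (y + (1/s) *\<^sub>R z)) = - z" for z
    using s by simp
  have "gauss_smooth s f y = (\<integral>z. (exp (- (norm z)\<^sup>2 / 2) / ?Z) *\<^sub>R f (y + z /\<^sub>R s) \<partial>lborel)"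
    unfolding gauss_smooth_def std by (rule integral_density) auto
  also have "\<dots> = (\<integral>z. f (y + (1/s) *\<^sub>R z) * exp (- (norm (s *\<^sub>R (y - (y + (1/s) *\<^sub>R z))))\<^sup>2 / 2) / ?Z \<partial>lborel)"
    unfolding cancel by (simp add: inverse_eq_divide mult.commute)
  also have "\<dots> = s ^ DIM('c) * (\<integral>z. (\<bar>1/s\<bar> ^ DIM('c)) *\<^sub>R (f (y + (1/s) *\<^sub>R z) * exp (- (norm (s *\<^sub>R (y - (y + (1/s) *\<^sub>R z))))\<^sup>2 / 2) / ?Z) \<partial>lborel)"
    unfolding integral_scaleR_right using s by (simp add: power_one_over)
  also have "(\<integral>z. (\<bar>1/s\<bar> ^ DIM('c)) *\<^sub>R (f (y + (1/s) *\<^sub>R z) * exp (- (norm (s *\<^sub>R (y - (y + (1/s) *\<^sub>R z))))\<^sup>2 / 2) / ?Z) \<partial>lborel)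
     = (\<integral>c. f c * exp (- (norm (s *\<^sub>R (y - c)))\<^sup>2 / 2) / ?Z \<partial>lborel)"
    using s by (intro lborel_integral_affine[symmetric]) auto
  finally show ?thesis by simp
qed

text \<open>For large \<open>s\<close> the displacement \<open>z / s\<close> is below the modulus of continuity of \<open>f\<close>
  unless \<open>z\<close> lies in the far tail of the normal law, which contributes at most \<open>2 * B\<close> times its mass.\<close>

lemma gauss_smooth_uniform_approx:
  fixes f :: "'c::euclidean_space \<Rightarrow> real"
  assumes uc: "uniformly_continuous_on UNIV f" and B: "\<And>x. \<bar>f x\<bar> \<le> B" and e: "e > 0"
  shows "\<exists>s>0. \<forall>y. \<bar>gauss_smooth s f y - f y\<bar> < e"
proof -
  interpret G: prob_space "std_gauss :: 'c measure" by (intro prob_space_gauss_measure) simp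
  have fm [measurable]: "f \<in> borel_measurable borel"
    using uniformly_continuous_imp_continuous[OF uc] by (rule borel_measurable_continuous_onI)
  obtain d where d: "d > 0" and fd: "\<And>x y. dist x y < d \<Longrightarrow> dist (f x) (f y) < e/3"
    using uc e unfolding uniformly_continuous_on_def by (metis UNIV_I divide_pos_pos zero_less_numeral)
  have "(\<lambda>n. \<integral>z. (if real n \<le> norm z then 1 else 0 :: real) \<partial>(std_gauss :: 'c measure)) \<longlonglongrightarrow> (\<integral>z. 0 \<partial>(std_gauss :: 'c measure))"
  proof (rule integral_dominated_convergence[where w="\<lambda>_. 1 :: real"])
    show "AE z in (std_gauss :: 'c measure). (\<lambda>n. (if real n \<le> norm z then 1 else 0 :: real)) \<longlonglongrightarrow> 0"
    proof (intro AE_I2 tendsto_eventually)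
      fix z :: 'c
      obtain m where "norm z < real m" using reals_Archimedean2 by blast
      then show "\<forall>\<^sub>F n in sequentially. ((if real n \<le> norm z then 1 else 0 :: real)) = 0"
        by (auto simp: eventually_sequentially intro!: exI[of _ m])
    qed
  qed auto
  then have "(\<lambda>n. (2 * B) * (\<integral>z. (if real n \<le> norm z then 1 else 0) \<partial>(std_gauss :: 'c measure))) \<longlonglongrightarrow> (2 * B) * 0"
    by (intro tendsto_mult tendsto_const) simp
  then have "\<forall>\<^sub>F n in sequentially. 2 * B * (\<integral>z. (if real n \<le> norm z then 1 else 0) \<partial>(std_gauss :: 'c measure)) < e/3"
    by (rule order_tendstoD) (use e in auto)
  from eventually_happens[OF eventually_conj[OF this eventually_gt_at_top[of 0]]]
  obtain n :: nat where n: "2 * B * (\<integral>z. (if real n \<le> norm z then 1 else 0) \<partial>(std_gauss :: 'c measure)) < e/3" "n > 0"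
    by auto
  \<comment> \<open>A displacement \<open>z / s\<close> with \<open>norm z < n\<close> is shorter than \<open>d\<close>.\<close>
  define s where "s = real n / d"
  have s: "s > 0" using n d by (simp add: s_def)
  have B0: "0 \<le> B" using B[of 0] by linarith
  have far_int: "integrable (std_gauss :: 'c measure) (\<lambda>z. if real n \<le> norm z then 1 else 0 :: real)"
    by (rule G.integrable_const_bound[where B=1]) auto
  have "\<bar>gauss_smooth s f y - f y\<bar> < e" for y
  proof -
    have "integrable std_gauss (\<lambda>z. f (y + z /\<^sub>R s))"
      by (rule G.integrable_const_bound[where B=B]) (use B in auto)
    then have "gauss_smooth s f y - f y = (\<integral>z. f (y + z /\<^sub>R s) - f y \<partial>std_gauss)"
      unfolding gauss_smooth_def using G.prob_space by simp
    also have "\<bar>\<dots>\<bar> \<le> (\<integral>z. \<bar>f (y + z /\<^sub>R s) - f y\<bar> \<partial>std_gauss)"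
      by (rule integral_abs_bound)
    also have "\<dots> \<le> (\<integral>z. e/3 + 2 * B * (if real n \<le> norm z then 1 else 0) \<partial>(std_gauss :: 'c measure))"
    proof (rule integral_mono')
      show "integrable std_gauss (\<lambda>z::'c. e/3 + 2 * B * (if real n \<le> norm z then 1 else 0))"
        by (rule G.integrable_const_bound[where B="e/3 + 2*B"]) (use B0 e in \<open>auto simp: indicator_def\<close>)
      fix z :: 'c
      show "\<bar>f (y + z /\<^sub>R s) - f y\<bar> \<le> e/3 + 2 * B * (if real n \<le> norm z then 1 else 0)"
      proof (cases "real n \<le> norm z")
        case True
        then show ?thesis using B[of "y + z /\<^sub>R s"] B[of y] e by simp
      next
        case False
        then have "dist (y + z /\<^sub>R s) y < d"
          using d n s by (simp add: dist_norm s_def field_simps)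
        from fd[OF this] show ?thesis using False by (simp add: dist_real_def)
      qed
    qed (use e B0 in auto)
    also have "\<dots> = e/3 + 2 * B * (\<integral>z. (if real n \<le> norm z then 1 else 0) \<partial>(std_gauss :: 'c measure))"
      using G.prob_space far_int by (subst Bochner_Integration.integral_add) auto
    finally show ?thesis using n e by linarith
  qed
  with s show ?thesis by blast
qed

locale char_fun_convergence =
  fixes D :: "nat \<Rightarrow> 'c::euclidean_space measure" and N :: "'c measure"
  assumes prob_D: "\<And>n. prob_space (D n)"
    and sets_D [measurable_cong]: "\<And>n. sets (D n) = sets borel"
    and prob_N: "prob_space N"
    and sets_N [measurable_cong]: "sets N = sets borel"
    and char_lim: "\<And>u. (\<lambda>n. \<integral>\<omega>. iexp (u \<bullet> \<omega>) \<partial>D n) \<longlonglongrightarrow> (\<integral>y. iexp (u \<bullet> y) \<partial>N)"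
begin

lemma idD: "(\<lambda>x. x) \<in> borel_measurable (D n)"
  by (rule measurable_ident_sets[OF sets_D])

lemma idN: "(\<lambda>x. x) \<in> borel_measurable N"
  by (rule measurable_ident_sets[OF sets_N])

lemma gauss_kernel_limit:
  "(\<lambda>n. \<integral>\<omega>. exp (- (norm (s *\<^sub>R (\<omega> - c)))\<^sup>2 / 2) \<partial>D n)
     \<longlonglongrightarrow> (\<integral>y. exp (- (norm (s *\<^sub>R (y - c)))\<^sup>2 / 2) \<partial>N)"
proof -
  interpret G: prob_space "std_gauss :: 'c measure" by (intro prob_space_gauss_measure) simp
  interpret N: prob_space N by (rule prob_N)
  have meas: "(\<lambda>x. \<integral>\<omega>. iexp ((s *\<^sub>R x) \<bullet> \<omega>) \<partial>D n) \<in> borel_measurable std_gauss" for n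
  proof -
    interpret M: prob_space "D n" by (rule prob_D)
    show ?thesis by measurable
  qed
  have "(\<lambda>n. complex_of_real (\<integral>\<omega>. exp (- (norm (s *\<^sub>R (\<omega> - c)))\<^sup>2 / 2) \<partial>D n))
     \<longlonglongrightarrow> complex_of_real (\<integral>y. exp (- (norm (s *\<^sub>R (y - c)))\<^sup>2 / 2) \<partial>N)"
    unfolding gauss_kernel_expectation[OF prob_D idD]
    unfolding gauss_kernel_expectation[OF prob_N idN]
  proof (rule integral_dominated_convergence[where w="\<lambda>_. 1"])
    show "(\<lambda>x. (\<integral>y. iexp ((s *\<^sub>R x) \<bullet> y) \<partial>N) * iexp (- ((s *\<^sub>R x) \<bullet> c))) \<in> borel_measurable std_gauss"
      by measurable
    show "(\<lambda>x. (\<integral>\<omega>. iexp ((s *\<^sub>R x) \<bullet> \<omega>) \<partial>D n) * iexp (- ((s *\<^sub>R x) \<bullet> c))) \<in> borel_measurable std_gauss" for n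
      by (intro borel_measurable_times meas) measurable
    show "AE x in std_gauss. (\<lambda>n. (\<integral>\<omega>. iexp ((s *\<^sub>R x) \<bullet> \<omega>) \<partial>D n) * iexp (- ((s *\<^sub>R x) \<bullet> c)))
        \<longlonglongrightarrow> (\<integral>y. iexp ((s *\<^sub>R x) \<bullet> y) \<partial>N) * iexp (- ((s *\<^sub>R x) \<bullet> c))"
      by (intro AE_I2 tendsto_mult char_lim tendsto_const)
    show "AE x in std_gauss. norm ((\<integral>\<omega>. iexp ((s *\<^sub>R x) \<bullet> \<omega>) \<partial>D n) * iexp (- ((s *\<^sub>R x) \<bullet> c))) \<le> 1" for n
    proof (intro AE_I2)
      fix x
      interpret M: prob_space "D n" by (rule prob_D)
      have "norm (\<integral>\<omega>. iexp ((s *\<^sub>R x) \<bullet> \<omega>) \<partial>D n) \<le> (\<integral>\<omega>. norm (iexp ((s *\<^sub>R x) \<bullet> \<omega>)) \<partial>D n)"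
        by (rule integral_norm_bound)
      then show "norm ((\<integral>\<omega>. iexp ((s *\<^sub>R x) \<bullet> \<omega>) \<partial>D n) * iexp (- ((s *\<^sub>R x) \<bullet> c))) \<le> 1"
        by (simp add: norm_mult M.prob_space)
    qed
  qed simp
  then show ?thesis by (simp only: tendsto_of_real_iff)
qed

text \<open>Bumps converge at every centre, and integrating over the centres against the integrable weight
  \<open>f\<close> preserves this by dominated convergence.\<close>

lemma gauss_smooth_limit:
  assumes s: "s > 0" and f: "integrable lborel f"
  shows "(\<lambda>n. \<integral>\<omega>. gauss_smooth s f \<omega> \<partial>D n) \<longlonglongrightarrow> (\<integral>y. gauss_smooth s f y \<partial>N)"
proof -
  have fm [measurable]: "f \<in> borel_measurable borel"
    using borel_measurable_integrable[OF f] by simp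
  let ?K = "\<lambda>c y. exp (- (norm (s *\<^sub>R (y - c)))\<^sup>2 / 2) :: real"
  have swap: "(\<integral>\<omega>. (\<integral>c. f c * ?K c \<omega> \<partial>lborel) \<partial>P) = (\<integral>c. f c * (\<integral>\<omega>. ?K c \<omega> \<partial>P) \<partial>lborel)"
    and Kle: "norm (\<integral>\<omega>. ?K c \<omega> \<partial>P) \<le> 1"
    and Km: "(\<lambda>c. \<integral>\<omega>. ?K c \<omega> \<partial>P) \<in> borel_measurable borel"
    if P: "prob_space P" and sets_P [measurable_cong]: "sets P = sets borel" for P :: "'c measure" and c
  proof -
    interpret P: prob_space P by fact
    interpret PL: pair_sigma_finite P "lborel :: 'c measure" ..
    have "integrable (P \<Otimes>\<^sub>M lborel) (case_prod (\<lambda>\<omega> c. f c))"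
      by (rule PL.Fubini_integrable) (use f in auto)
    then have int: "integrable (P \<Otimes>\<^sub>M lborel) (case_prod (\<lambda>\<omega> c. f c * ?K c \<omega>))"
      by (rule Bochner_Integration.integrable_bound)
         (auto simp: abs_mult intro!: AE_I2 mult_left_le)
    show "(\<integral>\<omega>. (\<integral>c. f c * ?K c \<omega> \<partial>lborel) \<partial>P) = (\<integral>c. f c * (\<integral>\<omega>. ?K c \<omega> \<partial>P) \<partial>lborel)"
      using PL.Fubini_integral[OF int] by simp
    have "norm (\<integral>\<omega>. ?K c \<omega> \<partial>P) \<le> (\<integral>\<omega>. norm (?K c \<omega>) \<partial>P)"
      by (rule integral_norm_bound)
    also have "\<dots> \<le> (\<integral>\<omega>. 1 \<partial>P)"
      by (rule integral_mono') auto
    finally show "norm (\<integral>\<omega>. ?K c \<omega> \<partial>P) \<le> 1" by (simp add: P.prob_space)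
    show "(\<lambda>c. \<integral>\<omega>. ?K c \<omega> \<partial>P) \<in> borel_measurable borel"
      by measurable
  qed
  have "(\<lambda>n. \<integral>c. f c * (\<integral>\<omega>. ?K c \<omega> \<partial>D n) \<partial>lborel) \<longlonglongrightarrow> (\<integral>c. f c * (\<integral>y. ?K c y \<partial>N) \<partial>lborel)"
  proof (rule integral_dominated_convergence[where w="\<lambda>c. \<bar>f c\<bar>"])
    show "AE c in lborel. norm (f c * (\<integral>\<omega>. ?K c \<omega> \<partial>D n)) \<le> \<bar>f c\<bar>" for n
      using Kle[OF prob_D sets_D] by (auto simp: abs_mult intro!: AE_I2 mult_left_le)
  qed (use f Km[OF prob_D sets_D] Km[OF prob_N sets_N] gauss_kernel_limit in \<open>auto intro!: AE_I2 tendsto_mult\<close>)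
  then show ?thesis
    unfolding gauss_smooth_eq_kernel_average[OF s fm]
    by (simp only: integral_mult_right_zero swap[OF prob_D sets_D] swap[OF prob_N sets_N])
       (rule tendsto_mult_left)
qed

text \<open>A continuous function of compact support is uniformly continuous, hence uniformly close to
  its smoothed version, for which the limit is known.\<close>

lemma compact_support_limit:
  fixes f :: "'c \<Rightarrow> real"
  assumes f: "continuous_on UNIV f" and supp: "\<And>x. norm x \<ge> r \<Longrightarrow> f x = 0"
  shows "(\<lambda>n. \<integral>\<omega>. f \<omega> \<partial>D n) \<longlonglongrightarrow> (\<integral>y. f y \<partial>N)"
proof -
  have fm [measurable]: "f \<in> borel_measurable borel"
    using f by (rule borel_measurable_continuous_onI)
  have "compact (f ` cball 0 r)"
    by (intro compact_continuous_image continuous_on_subset[OF f]) auto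
  then obtain B0 where B0: "\<And>x. x \<in> cball 0 r \<Longrightarrow> \<bar>f x\<bar> \<le> B0"
    by (metis bounded_iff compact_imp_bounded imageI real_norm_def)
  define B where "B = max 0 B0"
  have B: "\<bar>f x\<bar> \<le> B" for x
    using B0[of x] supp[of x] by (cases "norm x \<le> r") (auto simp: B_def)
  have f_ind: "f = (\<lambda>x. indicator (cball 0 r) x *\<^sub>R f x)"
    using supp by (auto simp: indicator_def fun_eq_iff)
  have int: "integrable lborel f"
    by (subst f_ind) (intro borel_integrable_compact continuous_on_subset[OF f]; auto)
  have uc: "uniformly_continuous_on UNIV f"
    unfolding uniformly_continuous_on_def
  proof (intro allI impI)
    fix e :: real assume "e > 0"
    have "uniformly_continuous_on (cball 0 (r + 1)) f"
      by (intro compact_uniformly_continuous continuous_on_subset[OF f]) auto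
    then obtain d where d: "d > 0"
      "\<And>x y. x \<in> cball 0 (r + 1) \<Longrightarrow> y \<in> cball 0 (r + 1) \<Longrightarrow> dist y x < d \<Longrightarrow> dist (f y) (f x) < e"
      using \<open>e > 0\<close> unfolding uniformly_continuous_on_def by metis
    have "dist (f y) (f x) < e" if xy: "dist y x < min d 1" for x y
    proof (cases "norm x \<le> r \<or> norm y \<le> r")
      case True
      have "norm x \<le> norm y + 1" "norm y \<le> norm x + 1"
        using xy norm_triangle_ineq3[of x y] by (auto simp: dist_norm norm_minus_commute)
      with True have "x \<in> cball 0 (r + 1)" "y \<in> cball 0 (r + 1)" by auto
      then show ?thesis using d(2) xy by auto
    next
      case False
      then show ?thesis using supp[of x] supp[of y] \<open>e > 0\<close> by simp
    qed
    then show "\<exists>d>0. \<forall>x\<in>UNIV. \<forall>y\<in>UNIV. dist y x < d \<longrightarrow> dist (f y) (f x) < e"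
      using d(1) by (intro exI[of _ "min d 1"]) auto
  qed
  show ?thesis
  proof (rule LIMSEQ_I)
    fix e :: real assume e: "e > 0"
    obtain s where s: "s > 0" and close: "\<And>y. \<bar>gauss_smooth s f y - f y\<bar> < e/3"
      using gauss_smooth_uniform_approx[OF uc B, of "e/3"] e by auto
    have gm [measurable]: "gauss_smooth s f \<in> borel_measurable borel"
    proof -
      interpret G: prob_space "std_gauss :: 'c measure" by (intro prob_space_gauss_measure) simp
      show ?thesis unfolding gauss_smooth_def[abs_def] by measurable
    qed
    have near: "\<bar>(\<integral>\<omega>. gauss_smooth s f \<omega> \<partial>P) - (\<integral>\<omega>. f \<omega> \<partial>P)\<bar> \<le> e/3"
      if P: "prob_space P" and sets_P [measurable_cong]: "sets P = sets borel" for P :: "'c measure"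
    proof -
      interpret P: prob_space P by fact
      have i1: "integrable P (\<lambda>\<omega>. f \<omega>)"
        by (rule P.integrable_const_bound[where B=B]) (use B in auto)
      have gb: "\<bar>gauss_smooth s f y\<bar> \<le> B + e/3" for y
        using B[of y] close[of y] by linarith
      have i2: "integrable P (\<lambda>\<omega>. gauss_smooth s f \<omega>)"
        by (rule P.integrable_const_bound[where B="B + e/3"]) (use gb in auto)
      have "\<bar>(\<integral>\<omega>. gauss_smooth s f \<omega> \<partial>P) - (\<integral>\<omega>. f \<omega> \<partial>P)\<bar>
         \<le> (\<integral>\<omega>. \<bar>gauss_smooth s f \<omega> - f \<omega>\<bar> \<partial>P)"
        unfolding Bochner_Integration.integral_diff[OF i2 i1, symmetric] by (rule integral_abs_bound)
      also have "\<dots> \<le> (\<integral>\<omega>. e/3 \<partial>P)"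
        using e close by (intro integral_mono') (auto intro: less_imp_le)
      finally show ?thesis by (simp add: P.prob_space)
    qed
    have "e/3 > 0" using e by simp
    from LIMSEQ_D[OF gauss_smooth_limit[OF s int] this]
    obtain n0 where n0: "\<And>n. n \<ge> n0 \<Longrightarrow>
        \<bar>(\<integral>\<omega>. gauss_smooth s f \<omega> \<partial>D n) - (\<integral>y. gauss_smooth s f y \<partial>N)\<bar> < e/3"
      unfolding real_norm_def by blast
    have "\<bar>(\<integral>\<omega>. f \<omega> \<partial>D n) - (\<integral>y. f y \<partial>N)\<bar> < e" if "n \<ge> n0" for n
      using n0[OF that] near[OF prob_D sets_D, of n] near[OF prob_N sets_N] by linarith
    then show "\<exists>n0. \<forall>n\<ge>n0. norm ((\<integral>\<omega>. f \<omega> \<partial>D n) - (\<integral>y. f y \<partial>N)) < e"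
      by auto
  qed
qed

text \<open>Compactly supported cutoffs \<open>\<kappa> k\<close> increase to \<open>1\<close>. The limit law gives almost all
  mass to one of them, and so do the laws in the sequence from some index on, because the expectation of the
  cutoff converges. No mass escapes to infinity, and \<open>f\<close> may be replaced by its product with the cutoff.\<close>

lemma bounded_continuous_limit:
  fixes f :: "'c \<Rightarrow> real"
  assumes f: "continuous_on UNIV f" and bdd: "bounded (range f)"
  shows "(\<lambda>n. \<integral>\<omega>. f \<omega> \<partial>D n) \<longlonglongrightarrow> (\<integral>y. f y \<partial>N)"
proof -
  interpret N: prob_space N by (rule prob_N)
  have fm [measurable]: "f \<in> borel_measurable borel"
    using f by (rule borel_measurable_continuous_onI)
  obtain B where B: "B > 0" "\<And>x. \<bar>f x\<bar> \<le> B"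
    using bdd unfolding bounded_pos by auto
  define \<kappa> :: "nat \<Rightarrow> 'c \<Rightarrow> real" where "\<kappa> k y = max 0 (min 1 (real k + 1 - norm y))" for k y
  have \<kappa>_cont: "continuous_on UNIV (\<kappa> k)" for k unfolding \<kappa>_def by (intro continuous_intros)
  have [measurable]: "\<kappa> k \<in> borel_measurable borel" for k
    using \<kappa>_cont by (rule borel_measurable_continuous_onI)
  have \<kappa>_range: "0 \<le> \<kappa> k y" "\<kappa> k y \<le> 1" for k y by (auto simp: \<kappa>_def)
  have \<kappa>_supp: "\<kappa> k y = 0" if "norm y \<ge> real k + 1" for k y using that by (auto simp: \<kappa>_def)
  have "(\<lambda>k. \<integral>y. \<kappa> k y \<partial>N) \<longlonglongrightarrow> (\<integral>y. 1 \<partial>N)"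
  proof (rule integral_dominated_convergence[where w="\<lambda>_. 1 :: real"])
    show "AE y in N. (\<lambda>k. \<kappa> k y) \<longlonglongrightarrow> 1"
    proof (intro AE_I2 tendsto_eventually)
      fix y :: 'c
      obtain m where "norm y < real m" using reals_Archimedean2 by blast
      then show "\<forall>\<^sub>F k in sequentially. \<kappa> k y = 1"
        by (auto simp: eventually_sequentially \<kappa>_def intro!: exI[of _ m])
    qed
  qed (use \<kappa>_range in auto)
  then have \<kappa>_lim: "(\<lambda>k. \<integral>y. \<kappa> k y \<partial>N) \<longlonglongrightarrow> 1" by (simp add: N.prob_space)
  show ?thesis
  proof (rule LIMSEQ_I)
    fix e :: real assume e: "e > 0"
    define d where "d = e / (4 * B)"
    have d: "d > 0" "B * d = e/4" using e B by (auto simp: d_def)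
    have "\<forall>\<^sub>F k in sequentially. 1 - d < (\<integral>y. \<kappa> k y \<partial>N)"
      by (rule order_tendstoD[OF \<kappa>_lim]) (use d in auto)
    then obtain k where k: "1 - d < (\<integral>y. \<kappa> k y \<partial>N)"
      by (metis eventually_happens sequentially_bot)
    have "(\<lambda>n. \<integral>\<omega>. \<kappa> k \<omega> \<partial>D n) \<longlonglongrightarrow> (\<integral>y. \<kappa> k y \<partial>N)"
      by (rule compact_support_limit[OF \<kappa>_cont \<kappa>_supp])
    then have "\<forall>\<^sub>F n in sequentially. 1 - d < (\<integral>\<omega>. \<kappa> k \<omega> \<partial>D n)"
      by (rule order_tendstoD) (rule k)
    then obtain n1 where n1: "\<And>n. n \<ge> n1 \<Longrightarrow> 1 - d < (\<integral>\<omega>. \<kappa> k \<omega> \<partial>D n)"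
      by (auto simp: eventually_sequentially)
    have "(\<lambda>n. \<integral>\<omega>. f \<omega> * \<kappa> k \<omega> \<partial>D n) \<longlonglongrightarrow> (\<integral>y. f y * \<kappa> k y \<partial>N)"
      by (rule compact_support_limit[of "\<lambda>y. f y * \<kappa> k y" "real k + 1"])
        (use \<kappa>_supp in \<open>auto intro!: continuous_intros f \<kappa>_cont\<close>)
    from LIMSEQ_D[OF this, of "e/4"]
    obtain n2 where n2: "\<And>n. n \<ge> n2 \<Longrightarrow>
        \<bar>(\<integral>\<omega>. f \<omega> * \<kappa> k \<omega> \<partial>D n) - (\<integral>y. f y * \<kappa> k y \<partial>N)\<bar> < e/4"
      unfolding real_norm_def using e by auto
    have trunc: "\<bar>(\<integral>\<omega>. f \<omega> \<partial>P) - (\<integral>\<omega>. f \<omega> * \<kappa> k \<omega> \<partial>P)\<bar> < e/4"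
      if P: "prob_space P" and sets_P [measurable_cong]: "sets P = sets borel"
        and mass: "1 - d < (\<integral>\<omega>. \<kappa> k \<omega> \<partial>P)" for P :: "'c measure"
    proof -
      interpret P: prob_space P by fact
      have i1: "integrable P (\<lambda>\<omega>. f \<omega>)"
        by (rule P.integrable_const_bound[where B=B]) (use B in auto)
      have i2: "integrable P (\<lambda>\<omega>. f \<omega> * \<kappa> k \<omega>)"
      proof (rule P.integrable_const_bound[where B=B])
        have "\<bar>f x * \<kappa> k x\<bar> \<le> B * 1" for x
          unfolding abs_mult using B \<kappa>_range by (intro mult_mono) auto
        then show "AE \<omega> in P. norm (f \<omega> * \<kappa> k \<omega>) \<le> B" by simp
      qed measurable
      have i3: "integrable P (\<lambda>\<omega>. \<kappa> k \<omega>)"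
        by (rule P.integrable_const_bound[where B=1]) (use \<kappa>_range in auto)
      have "\<bar>(\<integral>\<omega>. f \<omega> \<partial>P) - (\<integral>\<omega>. f \<omega> * \<kappa> k \<omega> \<partial>P)\<bar>
         \<le> (\<integral>\<omega>. \<bar>f \<omega> - f \<omega> * \<kappa> k \<omega>\<bar> \<partial>P)"
        unfolding Bochner_Integration.integral_diff[OF i1 i2, symmetric] by (rule integral_abs_bound)
      also have "\<dots> \<le> (\<integral>\<omega>. B * (1 - \<kappa> k \<omega>) \<partial>P)"
      proof (rule integral_mono')
        show "integrable P (\<lambda>\<omega>. B * (1 - \<kappa> k \<omega>))" using i3 by auto
        fix \<omega>
        have "\<bar>f \<omega> - f \<omega> * \<kappa> k \<omega>\<bar> = \<bar>f \<omega>\<bar> * (1 - \<kappa> k \<omega>)"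
          using \<kappa>_range[of k "\<omega>"] abs_mult[of "f \<omega>" "1 - \<kappa> k \<omega>"]
          by (simp add: right_diff_distrib)
        also have "\<dots> \<le> B * (1 - \<kappa> k \<omega>)"
          using \<kappa>_range[of k "\<omega>"] B by (intro mult_right_mono) auto
        finally show "\<bar>f \<omega> - f \<omega> * \<kappa> k \<omega>\<bar> \<le> B * (1 - \<kappa> k \<omega>)" .
      qed (use B \<kappa>_range in auto)
      also have "\<dots> = B * (1 - (\<integral>\<omega>. \<kappa> k \<omega> \<partial>P))"
        using i3 by (simp add: P.prob_space)
      also have "\<dots> < B * d" using mass B by (intro mult_strict_left_mono) auto
      finally show ?thesis using d by simp
    qed
    have "\<bar>(\<integral>\<omega>. f \<omega> \<partial>D n) - (\<integral>y. f y \<partial>N)\<bar> < e" if "n \<ge> max n1 n2" for n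
      using trunc[OF prob_D sets_D n1, of n] trunc[OF prob_N sets_N k] n2[of n] that by linarith
    then show "\<exists>n0. \<forall>n\<ge>n0. norm ((\<integral>\<omega>. f \<omega> \<partial>D n) - (\<integral>y. f y \<partial>N)) < e"
      unfolding real_norm_def by blast
  qed
qed

end

text \<open>Only the laws of the \<open>Y n\<close> matter, so the result for measures on the Euclidean space
  applies to the image measures.\<close>

theorem levy_continuity_euclidean:
  fixes Y :: "nat \<Rightarrow> 'a \<Rightarrow> 'c::euclidean_space"
  assumes M: "\<And>n. prob_space (M n)" and Y [measurable]: "\<And>n. Y n \<in> borel_measurable (M n)"
    and N: "prob_space N" "sets N = sets borel"
    and lim: "\<And>u. (\<lambda>n. \<integral>\<omega>. iexp (u \<bullet> Y n \<omega>) \<partial>M n) \<longlonglongrightarrow> (\<integral>y. iexp (u \<bullet> y) \<partial>N)"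
  shows "conv_in_distr M Y N"
proof -
  interpret char_fun_convergence "\<lambda>n. distr (M n) borel (Y n)" N
  proof (rule char_fun_convergence.intro)
    show "prob_space (distr (M n) borel (Y n))" for n
      by (rule prob_space.prob_space_distr[OF M Y])
    show "(\<lambda>n. \<integral>\<omega>. iexp (u \<bullet> \<omega>) \<partial>distr (M n) borel (Y n)) \<longlonglongrightarrow> (\<integral>y. iexp (u \<bullet> y) \<partial>N)" for u
      using lim[of u] by (subst integral_distr) (auto simp del: of_real_exp)
  qed (use N in auto)
  show ?thesis unfolding conv_in_distr_def
  proof (intro conjI allI impI Y)
    fix f :: "'c \<Rightarrow> real" assume f: "continuous_on UNIV f" and bdd: "bounded (range f)"
    show "(\<lambda>n. \<integral>\<omega>. f (Y n \<omega>) \<partial>M n) \<longlonglongrightarrow> (\<integral>y. f y \<partial>N)"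
      using bounded_continuous_limit[OF f bdd] borel_measurable_continuous_onI[OF f]
      by (simp add: integral_distr)
  qed
qed

text \<open>The indicator of \<open>norm y > k + 1\<close> is dominated by a bounded continuous function whose
  expectation under the limit law is small for large \<open>k\<close>.\<close>

lemma conv_in_distr_tight:
  fixes Y :: "nat \<Rightarrow> 'a \<Rightarrow> 'c::euclidean_space"
  assumes conv: "conv_in_distr M Y N" and M: "\<And>n. prob_space (M n)"
    and N: "prob_space N" and sets_N [measurable_cong]: "sets N = sets borel" and e: "e > 0"
  shows "\<exists>B\<ge>0. \<forall>\<^sub>F n in sequentially. measure (M n) {\<omega> \<in> space (M n). B < norm (Y n \<omega>)} < e"
proof -
  interpret N: prob_space N by (rule N)
  have Y [measurable]: "Y n \<in> borel_measurable (M n)" for n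
    using conv by (simp add: conv_in_distr_def)
  define f :: "nat \<Rightarrow> 'c \<Rightarrow> real" where "f k y = max 0 (min 1 (norm y - real k))" for k y
  have f_cont: "continuous_on UNIV (f k)" for k unfolding f_def by (intro continuous_intros)
  have [measurable]: "f k \<in> borel_measurable borel" for k
    using f_cont by (rule borel_measurable_continuous_onI)
  have f_range: "0 \<le> f k y" "f k y \<le> 1" for k y by (auto simp: f_def)
  have f_bdd: "bounded (range (f k))" for k
    using f_range by (auto simp: bounded_iff intro!: exI[of _ 1])
  have "(\<lambda>k. \<integral>y. f k y \<partial>N) \<longlonglongrightarrow> (\<integral>y. 0 \<partial>N)"
  proof (rule integral_dominated_convergence[where w="\<lambda>_. 1 :: real"])
    show "AE y in N. (\<lambda>k. f k y) \<longlonglongrightarrow> 0"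
    proof (intro AE_I2 tendsto_eventually)
      fix y :: 'c
      obtain m where "norm y < real m" using reals_Archimedean2 by blast
      then show "\<forall>\<^sub>F k in sequentially. f k y = 0"
        by (auto simp: eventually_sequentially f_def intro!: exI[of _ m])
    qed
  qed (use f_range in auto)
  then have "(\<lambda>k. \<integral>y. f k y \<partial>N) \<longlonglongrightarrow> 0" by simp
  from order_tendstoD(2)[OF this e] obtain k where k: "(\<integral>y. f k y \<partial>N) < e"
    by (metis eventually_happens sequentially_bot)
  have "(\<lambda>n. \<integral>\<omega>. f k (Y n \<omega>) \<partial>M n) \<longlonglongrightarrow> (\<integral>y. f k y \<partial>N)"
    using conv f_cont f_bdd unfolding conv_in_distr_def by blast
  from order_tendstoD(2)[OF this k]
  have "\<forall>\<^sub>F n in sequentially. measure (M n) {\<omega> \<in> space (M n). real k + 1 < norm (Y n \<omega>)} < e"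
  proof eventually_elim
    case (elim n)
    interpret prob_space "M n" by (rule M)
    have "measure (M n) {\<omega> \<in> space (M n). real k + 1 < norm (Y n \<omega>)}
        = (\<integral>\<omega>. indicator {\<omega> \<in> space (M n). real k + 1 < norm (Y n \<omega>)} \<omega> \<partial>M n)"
      unfolding Bochner_Integration.integral_indicator by (rule arg_cong[where f="measure _"]) auto
    also have "\<dots> \<le> (\<integral>\<omega>. f k (Y n \<omega>) \<partial>M n)"
    proof (rule integral_mono')
      show "integrable (M n) (\<lambda>\<omega>. f k (Y n \<omega>))"
        by (rule integrable_const_bound[where B=1]) (use f_range in auto)
      show "indicator {\<omega> \<in> space (M n). real k + 1 < norm (Y n \<omega>)} \<omega> \<le> f k (Y n \<omega>)" for \<omega>
        using f_range[of k "Y n \<omega>"] by (auto simp: indicator_def f_def)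
    qed (use f_range in auto)
    finally show ?case using elim by linarith
  qed
  then show ?thesis by (intro exI[of _ "real k + 1"]) auto
qed

section \<open>Central limit theorem with an independent random parameter\<close>

lemma distr_Pair_indep_var2:
  assumes M: "prob_space M" and ind: "indep_var2 M S X N Y"
  shows "distr M (S \<Otimes>\<^sub>M N) (\<lambda>\<omega>. (X \<omega>, Y \<omega>)) = distr M S X \<Otimes>\<^sub>M distr M N Y"
proof -
  interpret prob_space M by fact
  have X [measurable]: "X \<in> M \<rightarrow>\<^sub>M S" and Y [measurable]: "Y \<in> M \<rightarrow>\<^sub>M N"
    and indep: "indep_set {X -` A \<inter> space M | A. A \<in> sets S} {Y -` B \<inter> space M | B. B \<in> sets N}"
    using ind unfolding indep_var2_def by auto
  interpret X: prob_space "distr M S X" by (rule prob_space_distr) measurable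
  interpret Y: prob_space "distr M N Y" by (rule prob_space_distr) measurable
  interpret XY: pair_prob_space "distr M S X" "distr M N Y" ..
  show ?thesis
  proof (rule pair_measure_eqI[symmetric])
    fix A B assume A: "A \<in> sets (distr M S X)" and B: "B \<in> sets (distr M N Y)"
    have "emeasure (distr M (S \<Otimes>\<^sub>M N) (\<lambda>\<omega>. (X \<omega>, Y \<omega>))) (A \<times> B)
        = emeasure M ((X -` A \<inter> space M) \<inter> (Y -` B \<inter> space M))"
      using A B by (subst emeasure_distr) (auto intro!: arg_cong[where f="emeasure M"])
    also have "\<dots> = ennreal (prob (X -` A \<inter> space M) * prob (Y -` B \<inter> space M))"
      using indep_setD[OF indep, of "X -` A \<inter> space M" "Y -` B \<inter> space M"] A B
      by (auto simp: emeasure_eq_measure)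
    also have "\<dots> = emeasure (distr M S X) A * emeasure (distr M N Y) B"
      using A B by (auto simp: emeasure_distr emeasure_eq_measure ennreal_mult)
    finally show "emeasure (distr M S X) A * emeasure (distr M N Y) B
        = emeasure (distr M (S \<Otimes>\<^sub>M N) (\<lambda>\<omega>. (X \<omega>, Y \<omega>))) (A \<times> B)" by simp
  qed (auto simp: X.sigma_finite_measure_axioms Y.sigma_finite_measure_axioms cong: sets_pair_measure_cong)
qed

text \<open>Conditionally on \<open>T\<close> the factors are i.i.d., so that the conditional expectation of the product
  is a power of the one-step expectation at the value of \<open>T\<close>. Independence makes the joint law a product
  measure, which turns this conditioning into Fubini's theorem.\<close>

lemma expectation_prod_iid_indep:
  fixes h :: "'t \<Rightarrow> 'p \<Rightarrow> complex"
  assumes M: "prob_space M"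
    and iid: "prob_space.indep_vars M (\<lambda>_. S) D {..<n}"
    and law: "\<And>i. i < n \<Longrightarrow> distr M S (D i) = Q" and Q: "prob_space Q"
    and ind: "indep_var2 M K T (Pi\<^sub>M {..<n} (\<lambda>_. S)) (\<lambda>\<omega>. \<lambda>i\<in>{..<n}. D i \<omega>)"
    and n: "n > 0"
    and h [measurable]: "case_prod h \<in> borel_measurable (K \<Otimes>\<^sub>M S)"
    and h1: "\<And>t p. norm (h t p) \<le> 1"
  shows "(\<integral>\<omega>. (\<Prod>i<n. h (T \<omega>) (D i \<omega>)) \<partial>M) = (\<integral>\<omega>. (\<integral>p. h (T \<omega>) p \<partial>Q) ^ n \<partial>M)"
proof -
  interpret prob_space M by fact
  interpret Q: prob_space Q by fact
  have T [measurable]: "T \<in> M \<rightarrow>\<^sub>M K" using ind by (simp add: indep_var2_def)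
  have D [measurable]: "D i \<in> M \<rightarrow>\<^sub>M S" if "i < n" for i
    using iid that by (simp add: indep_vars_def2)
  have sets_Q [measurable_cong]: "sets Q = sets S" using law[OF n] by (metis sets_distr)
  let ?V = "\<lambda>\<omega>. \<lambda>i\<in>{..<n}. D i \<omega>"
  have V [measurable]: "?V \<in> M \<rightarrow>\<^sub>M Pi\<^sub>M {..<n} (\<lambda>_. S)"
    by (intro measurable_restrict D) auto
  have lawV: "distr M (Pi\<^sub>M {..<n} (\<lambda>_. S)) ?V = Pi\<^sub>M {..<n} (\<lambda>_. Q)"
    using iid law D n
    by (subst (asm) indep_vars_iff_distr_eq_PiM') (auto intro!: PiM_cong)
  interpret PQ: product_prob_space "\<lambda>_. Q" "{..<n}" ..
  interpret T: prob_space "distr M K T" by (rule prob_space_distr) measurable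
  interpret TP: pair_prob_space "distr M K T" "Pi\<^sub>M {..<n} (\<lambda>_. Q)" ..
  have sets_PQ [measurable_cong]: "sets (Pi\<^sub>M {..<n} (\<lambda>_. Q)) = sets (Pi\<^sub>M {..<n} (\<lambda>_. S))"
    by (intro sets_PiM_cong sets_Q refl)
  have meas: "(\<lambda>(t, v). \<Prod>i<n. h t (v i)) \<in> borel_measurable (K \<Otimes>\<^sub>M Pi\<^sub>M {..<n} (\<lambda>_. S))"
    unfolding case_prod_beta
  proof (intro borel_measurable_prod)
    fix i assume "i \<in> {..<n}"
    then have [measurable]: "(\<lambda>x. snd x i) \<in> (K \<Otimes>\<^sub>M Pi\<^sub>M {..<n} (\<lambda>_. S)) \<rightarrow>\<^sub>M S"
      by measurable
    show "(\<lambda>x. h (fst x) (snd x i)) \<in> borel_measurable (K \<Otimes>\<^sub>M Pi\<^sub>M {..<n} (\<lambda>_. S))"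
      by measurable
  qed
  have int: "integrable (distr M K T \<Otimes>\<^sub>M Pi\<^sub>M {..<n} (\<lambda>_. Q)) (\<lambda>(t, v). \<Prod>i<n. h t (v i))"
    by (rule TP.P.integrable_const_bound[where B=1])
       (use meas in \<open>auto simp: prod_norm[symmetric] intro!: AE_I2 prod_le_1 h1 cong: measurable_cong_sets\<close>)
  have "(\<integral>\<omega>. (\<Prod>i<n. h (T \<omega>) (D i \<omega>)) \<partial>M)
      = (\<integral>\<omega>. (case (T \<omega>, ?V \<omega>) of (t, v) \<Rightarrow> \<Prod>i<n. h t (v i)) \<partial>M)"
    by (intro Bochner_Integration.integral_cong) auto
  also have "\<dots> = (\<integral>x. (case x of (t, v) \<Rightarrow> \<Prod>i<n. h t (v i))
      \<partial>distr M (K \<Otimes>\<^sub>M Pi\<^sub>M {..<n} (\<lambda>_. S)) (\<lambda>\<omega>. (T \<omega>, ?V \<omega>)))"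
    by (rule integral_distr[symmetric]) (use meas in measurable)
  also have "\<dots> = (\<integral>x. (case x of (t, v) \<Rightarrow> \<Prod>i<n. h t (v i)) \<partial>(distr M K T \<Otimes>\<^sub>M Pi\<^sub>M {..<n} (\<lambda>_. Q)))"
    unfolding distr_Pair_indep_var2[OF M ind] lawV ..
  also have "\<dots> = (\<integral>t. (\<integral>v. (\<Prod>i<n. h t (v i)) \<partial>Pi\<^sub>M {..<n} (\<lambda>_. Q)) \<partial>distr M K T)"
    using TP.integral_fst'[OF int] by simp
  also have "\<dots> = (\<integral>t. (\<integral>p. h t p \<partial>Q) ^ n \<partial>distr M K T)"
  proof (intro Bochner_Integration.integral_cong refl)
    fix t assume "t \<in> space (distr M K T)"
    then have [measurable]: "h t \<in> borel_measurable Q"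
      using measurable_compose[OF measurable_Pair1'[of t K S] h] by (simp cong: measurable_cong_sets add: sets_Q)
    have "integrable Q (h t)"
      by (rule Q.integrable_const_bound[where B=1]) (use h1 in auto)
    then show "(\<integral>v. (\<Prod>i<n. h t (v i)) \<partial>Pi\<^sub>M {..<n} (\<lambda>_. Q)) = (\<integral>p. h t p \<partial>Q) ^ n"
      by (subst PQ.product_integral_prod) auto
  qed
  also have "\<dots> = (\<integral>\<omega>. (\<integral>p. h (T \<omega>) p \<partial>Q) ^ n \<partial>M)"
    by (rule integral_distr) measurable
  finally show ?thesis .
qed

text \<open>The characteristic function of a bounded centred variable up to second order. Apart from \<open>s\<close>, the
  error involves only the bound \<open>C\<close>, which makes the estimate uniform over families of variables.\<close>

lemma norm_char_taylor2:
  assumes Q: "prob_space Q" and f [measurable]: "f \<in> borel_measurable Q"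
    and C: "\<And>x. x \<in> space Q \<Longrightarrow> \<bar>f x\<bar> \<le> C"
    and mean: "(\<integral>x. f x \<partial>Q) = 0" and var: "(\<integral>x. (f x)\<^sup>2 \<partial>Q) = v"
  shows "norm ((\<integral>x. iexp (s * f x) \<partial>Q) - complex_of_real (1 - s\<^sup>2 * v / 2)) \<le> \<bar>s\<bar> ^ 3 * C ^ 3 / 6"
proof -
  interpret prob_space Q by fact
  have int1: "integrable Q f"
    by (rule integrable_const_bound[where B=C]) (use C in auto)
  have int2: "integrable Q (\<lambda>x. (f x)\<^sup>2)"
  proof (rule integrable_const_bound[where B="C\<^sup>2"])
    show "AE x in Q. norm ((f x)\<^sup>2) \<le> C\<^sup>2"
      using C by (auto simp: abs_le_square_iff[symmetric] intro: order_trans[OF _ abs_ge_self])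
  qed measurable
  have int3: "integrable Q (\<lambda>x. iexp (s * f x))"
    by (rule integrable_const_bound[where B=1]) auto
  let ?p = "\<lambda>y. complex_of_real (1 - y\<^sup>2 / 2) + \<i> * complex_of_real y"
  have int4: "integrable Q (\<lambda>x. 1 - (s * f x)\<^sup>2 / 2)" and int5: "integrable Q (\<lambda>x. s * f x)"
    using int1 int2 by (simp_all add: power_mult_distrib)
  have intp: "integrable Q (\<lambda>x. ?p (s * f x))"
    by (intro Bochner_Integration.integrable_add integrable_mult_right integrable_of_real int4 int5)
  have "(\<integral>x. 1 - (s * f x)\<^sup>2 / 2 \<partial>Q) = 1 - s\<^sup>2 * v / 2"
    using int2 by (simp add: power_mult_distrib var prob_space)
  moreover have "(\<integral>x. s * f x \<partial>Q) = 0" by (simp add: mean)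
  moreover have "(\<integral>x. ?p (s * f x) \<partial>Q)
      = (\<integral>x. complex_of_real (1 - (s * f x)\<^sup>2 / 2) \<partial>Q) + (\<integral>x. \<i> * complex_of_real (s * f x) \<partial>Q)"
    by (intro Bochner_Integration.integral_add integrable_mult_right integrable_of_real int4 int5)
  ultimately have valp: "(\<integral>x. ?p (s * f x) \<partial>Q) = complex_of_real (1 - s\<^sup>2 * v / 2)"
    by (simp only: integral_mult_right_zero integral_complex_of_real) simp
  have taylor: "norm (iexp y - ?p y) \<le> \<bar>y\<bar> ^ 3 / 6" for y
    using iexp_approx1[of y 2]
    by (simp add: numeral_2_eq_2 power_mult_distrib fact_numeral numeral_3_eq_3 algebra_simps)
  have "norm ((\<integral>x. iexp (s * f x) \<partial>Q) - complex_of_real (1 - s\<^sup>2 * v / 2))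
      = norm (\<integral>x. iexp (s * f x) - ?p (s * f x) \<partial>Q)"
    unfolding valp[symmetric] Bochner_Integration.integral_diff[OF int3 intp] ..
  also have "\<dots> \<le> (\<integral>x. norm (iexp (s * f x) - ?p (s * f x)) \<partial>Q)" by (rule integral_norm_bound)
  also have "\<dots> \<le> (\<integral>x. \<bar>s\<bar> ^ 3 * C ^ 3 / 6 \<partial>Q)"
  proof (rule integral_mono')
    fix x assume x: "x \<in> space Q"
    have "\<bar>s * f x\<bar> ^ 3 \<le> \<bar>s\<bar> ^ 3 * C ^ 3"
      unfolding abs_mult power_mult_distrib using C[OF x] by (intro mult_left_mono power_mono) auto
    then show "norm (iexp (s * f x) - ?p (s * f x)) \<le> \<bar>s\<bar> ^ 3 * C ^ 3 / 6"
      using taylor[of "s * f x"] by linarith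
    show "0 \<le> \<bar>s\<bar> ^ 3 * C ^ 3 / 6" using C[OF x] by simp
  qed simp
  finally show ?thesis by (simp add: prob_space)
qed

text \<open>A central limit theorem for sums whose summands share a random parameter \<open>\<tau>\<close> that is
  independent of the sample. While the parameter lies in \<open>A\<close>, the one-step characteristic function is within
  order \<open>n powr (-3/2)\<close> of \<open>1 - v / (2 n)\<close> uniformly in the parameter, and the variance \<open>v\<close> does not
  depend on it; hence all conditional laws have the same limit. Leaving \<open>A\<close> costs at most twice its probability.\<close>

lemma mixture_clt_char:
  fixes f :: "'t \<Rightarrow> 'p \<Rightarrow> real"
  assumes M: "\<And>n. prob_space (M n)"
    and iid: "\<And>n. prob_space.indep_vars (M n) (\<lambda>_. S) (D n) {..<n}"
    and law: "\<And>n i. i < n \<Longrightarrow> distr (M n) S (D n i) = Q" and Q: "prob_space Q"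
    and ind: "\<And>n. indep_var2 (M n) K (\<tau> n) (Pi\<^sub>M {..<n} (\<lambda>_. S)) (\<lambda>\<omega>. \<lambda>i\<in>{..<n}. D n i \<omega>)"
    and f [measurable]: "case_prod f \<in> borel_measurable (K \<Otimes>\<^sub>M S)"
    and A [measurable]: "A \<in> sets K"
    and bnd: "\<And>t p. t \<in> A \<Longrightarrow> \<bar>f t p\<bar> \<le> C"
    and mean: "\<And>t. t \<in> A \<Longrightarrow> (\<integral>p. f t p \<partial>Q) = 0"
    and var: "\<And>t. t \<in> A \<Longrightarrow> (\<integral>p. (f t p)\<^sup>2 \<partial>Q) = v"
    and v: "v \<ge> 0" and C: "C \<ge> 0"
    and conc: "(\<lambda>n. measure (M n) {\<omega> \<in> space (M n). \<tau> n \<omega> \<notin> A}) \<longlonglongrightarrow> 0"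
  shows "(\<lambda>n. \<integral>\<omega>. iexp ((\<Sum>i<n. f (\<tau> n \<omega>) (D n i \<omega>)) / sqrt (real n)) \<partial>M n)
    \<longlonglongrightarrow> complex_of_real (exp (- v / 2))"
proof -
  interpret Q: prob_space Q by fact
  define c where "c n = (1 + (- v / 2) / real n) ^ n" for n
  let ?I = "\<lambda>n. \<integral>\<omega>. iexp ((\<Sum>i<n. f (\<tau> n \<omega>) (D n i \<omega>)) / sqrt (real n)) \<partial>M n"
  let ?bad = "\<lambda>n. measure (M n) {\<omega> \<in> space (M n). \<tau> n \<omega> \<notin> A}"
  obtain n1 :: nat where n1: "v / 4 \<le> real n1" using real_arch_simple by blast
  have bound: "norm (?I n - complex_of_real (c n)) \<le> C ^ 3 / 6 * (1 / sqrt (real n)) + 2 * ?bad n"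
    if n: "n > 0" "n \<ge> n1" for n
  proof -
    interpret prob_space "M n" by (rule M)
    define s where "s = 1 / sqrt (real n)"
    have s2: "s\<^sup>2 = 1 / real n" by (simp add: s_def power_divide)
    have s0: "s > 0" using n by (simp add: s_def)
    have [measurable]: "\<tau> n \<in> M n \<rightarrow>\<^sub>M K" using ind by (simp add: indep_var2_def)
    have sets_Q [measurable_cong]: "sets Q = sets S" using law[of 0 n] n by (metis sets_distr)
    define \<psi> where "\<psi> t = (\<integral>p. iexp (s * f t p) \<partial>Q)" for t
    define z where "z = 1 - s\<^sup>2 * v / 2"
    have [measurable]: "\<psi> \<in> borel_measurable K" unfolding \<psi>_def by measurable
    have \<psi>1: "norm (\<psi> t) \<le> 1" for t
    proof -
      have "norm (\<psi> t) \<le> (\<integral>p. norm (iexp (s * f t p)) \<partial>Q)" unfolding \<psi>_def by (rule integral_norm_bound)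
      then show ?thesis by (simp add: Q.prob_space)
    qed
    have z1: "\<bar>z\<bar> \<le> 1"
    proof -
      have "v / 4 \<le> real n" using n1 n by linarith
      then have "v / real n \<le> 4" using n by (simp add: divide_le_eq)
      then show ?thesis using v by (simp add: z_def s2 abs_le_iff)
    qed
    have cn: "c n = z ^ n" by (simp add: c_def z_def s2 mult.commute)
    have "?I n = (\<integral>\<omega>. (\<Prod>i<n. iexp (s * f (\<tau> n \<omega>) (D n i \<omega>))) \<partial>M n)"
      by (simp add: exp_sum[symmetric] s_def sum_divide_distrib sum_distrib_left)
    also have "\<dots> = (\<integral>\<omega>. \<psi> (\<tau> n \<omega>) ^ n \<partial>M n)"
      unfolding \<psi>_def by (rule expectation_prod_iid_indep[OF M iid law Q ind]) (use n in auto)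
    finally have I: "?I n = (\<integral>\<omega>. \<psi> (\<tau> n \<omega>) ^ n \<partial>M n)" .
    have pw: "norm (\<psi> t ^ n - complex_of_real z ^ n) \<le> C ^ 3 / 6 * s + 2 * indicator (- A) t" if t: "t \<in> space K" for t
    proof (cases "t \<in> A")
      case True
      have [measurable]: "f t \<in> borel_measurable Q"
        using measurable_compose[OF measurable_Pair1'[OF t, of S] f]
        by (simp cong: measurable_cong_sets add: sets_Q)
      have "norm (\<psi> t ^ n - complex_of_real z ^ n) \<le> real n * norm (\<psi> t - complex_of_real z)"
        using \<psi>1 z1 by (intro norm_power_diff) auto
      also have "\<dots> \<le> real n * (\<bar>s\<bar> ^ 3 * C ^ 3 / 6)"
        unfolding \<psi>_def z_def
        by (intro mult_left_mono norm_char_taylor2[OF Q _ bnd[OF True] mean[OF True] var[OF True]]) auto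
      also have "\<dots> = (real n * s\<^sup>2) * s * C ^ 3 / 6" using s0 by (simp add: power3_eq_cube power2_eq_square)
      also have "\<dots> = C ^ 3 / 6 * s" using n by (simp add: s2)
      finally show ?thesis using True by simp
    next
      case False
      have "norm (\<psi> t ^ n - complex_of_real z ^ n) \<le> norm (\<psi> t) ^ n + \<bar>z\<bar> ^ n"
        using norm_triangle_ineq4[of "\<psi> t ^ n" "complex_of_real z ^ n"] by (simp add: norm_power)
      also have "\<dots> \<le> 1 + 1" using \<psi>1 z1 by (intro add_mono power_le_one) auto
      finally show ?thesis using False C s0 by (simp add: add_increasing)
    qed
    have int\<psi>: "integrable (M n) (\<lambda>\<omega>. \<psi> (\<tau> n \<omega>) ^ n)"
      by (rule integrable_const_bound[where B=1]) (auto simp: norm_power intro!: power_le_one \<psi>1)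
    have "norm (?I n - complex_of_real (c n)) = norm (\<integral>\<omega>. \<psi> (\<tau> n \<omega>) ^ n - complex_of_real z ^ n \<partial>M n)"
      unfolding I cn using int\<psi> by (subst Bochner_Integration.integral_diff) (auto simp: prob_space)
    also have "\<dots> \<le> (\<integral>\<omega>. norm (\<psi> (\<tau> n \<omega>) ^ n - complex_of_real z ^ n) \<partial>M n)"
      by (rule integral_norm_bound)
    also have "\<dots> \<le> (\<integral>\<omega>. C ^ 3 / 6 * s + 2 * indicator {\<omega> \<in> space (M n). \<tau> n \<omega> \<notin> A} \<omega> \<partial>M n)"
    proof (rule integral_mono')
      show "integrable (M n) (\<lambda>\<omega>. C ^ 3 / 6 * s + 2 * indicator {\<omega> \<in> space (M n). \<tau> n \<omega> \<notin> A} \<omega>)"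
        by (rule integrable_const_bound[where B="C ^ 3 / 6 * s + 2"]) (use C s0 in \<open>auto simp: indicator_def\<close>)
      fix \<omega> assume \<omega>: "\<omega> \<in> space (M n)"
      then have "\<tau> n \<omega> \<in> space K" by (rule measurable_space[OF \<open>\<tau> n \<in> M n \<rightarrow>\<^sub>M K\<close>])
      from pw[OF this] show "norm (\<psi> (\<tau> n \<omega>) ^ n - complex_of_real z ^ n)
          \<le> C ^ 3 / 6 * s + 2 * indicator {\<omega> \<in> space (M n). \<tau> n \<omega> \<notin> A} \<omega>"
        using \<omega> by (simp add: indicator_def)
    qed (use C s0 in auto)
    also have "\<dots> = C ^ 3 / 6 * s + 2 * ?bad n"
      by (subst Bochner_Integration.integral_add) (auto simp: prob_space emeasure_eq_measure Int_absorb2 subset_eq)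
    finally show ?thesis by (simp add: s_def)
  qed
  have "(\<lambda>n. C ^ 3 / 6 * (1 / sqrt (real n)) + 2 * ?bad n) \<longlonglongrightarrow> C ^ 3 / 6 * 0 + 2 * 0"
    by (intro tendsto_intros conc) real_asymp
  then have lim0: "(\<lambda>n. C ^ 3 / 6 * (1 / sqrt (real n)) + 2 * ?bad n) \<longlonglongrightarrow> 0" by simp
  have "(\<lambda>n. ?I n - complex_of_real (c n)) \<longlonglongrightarrow> 0"
    by (rule Lim_null_comparison[OF _ lim0])
       (use bound in \<open>auto simp: eventually_sequentially intro!: exI[of _ "max 1 n1"]\<close>)
  moreover have "(\<lambda>n. complex_of_real (c n)) \<longlonglongrightarrow> complex_of_real (exp (- v / 2))"
    unfolding c_def by (intro tendsto_of_real tendsto_exp_limit_sequentially)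
  ultimately have "(\<lambda>n. (?I n - complex_of_real (c n)) + complex_of_real (c n)) \<longlonglongrightarrow> 0 + complex_of_real (exp (- v / 2))"
    by (rule tendsto_add)
  then show ?thesis by simp
qed

section \<open>Tail probabilities in an exponential family\<close>

lemma natural_space_iff:
  "\<theta> \<in> natural_space \<mu> T \<longleftrightarrow> (\<integral>\<^sup>+x. ennreal (exp (\<theta> * T x)) \<partial>\<mu>) < \<infinity>"
  by (auto simp: natural_space_def log_partition_def Let_def less_top)

lemma exp_remainder_bound: "\<bar>exp x - 1 - x\<bar> \<le> x\<^sup>2 * exp \<bar>x\<bar>" for x :: real
proof -
  obtain t where t: "\<bar>t\<bar> \<le> \<bar>x\<bar>" "exp x = (\<Sum>m<2. x ^ m / fact m) + exp t / fact 2 * x ^ 2"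
    using Maclaurin_exp_le[of x 2] by auto
  have "exp x - 1 - x = exp t / 2 * x\<^sup>2"
    using t(2) by (simp add: numeral_2_eq_2)
  then have "\<bar>exp x - 1 - x\<bar> = x\<^sup>2 * (exp t / 2)" by (simp only: abs_mult) simp
  also have "\<dots> \<le> x\<^sup>2 * exp \<bar>x\<bar>"
  proof (intro mult_left_mono)
    have "exp t \<le> exp \<bar>x\<bar>" "0 < exp \<bar>x\<bar>" using t(1) by auto
    then show "exp t / 2 \<le> exp \<bar>x\<bar>" by linarith
  qed simp
  finally show ?thesis .
qed

locale nondegenerate_exp_family =
  fixes \<mu> :: "'b measure" and T :: "'b \<Rightarrow> real" and \<theta>0 :: real
  assumes T_meas [measurable]: "T \<in> borel_measurable \<mu>"
    and theta0: "\<theta>0 \<in> interior (natural_space \<mu> T)"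
    and var_pos: "var_stat \<mu> T \<theta>0 > 0"
begin

definition partition_fun :: "real \<Rightarrow> real" where
  "partition_fun \<theta> = (\<integral>x. exp (\<theta> * T x) \<partial>\<mu>)"

definition tail_mass :: "real \<Rightarrow> real \<Rightarrow> real" where
  "tail_mass t \<theta> = (\<integral>x. indicator {t..} (T x) * exp (\<theta> * T x) \<partial>\<mu>)"

abbreviation P :: "'b measure" where "P \<equiv> exp_family \<mu> T \<theta>0"
abbreviation t0 :: real where "t0 \<equiv> mean_stat \<mu> T \<theta>0"
abbreviation J :: real where "J \<equiv> abs_dev_stat \<mu> T \<theta>0"
abbreviation tail :: "real \<Rightarrow> real \<Rightarrow> real" where "tail \<equiv> tail_prob \<mu> T"

text \<open>The covariance of \<open>T\<close> with the indicator of \<open>T \<ge> t\<close>, which is the derivative of the tail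
  probability in the parameter at \<open>\<theta>\<^sub>0\<close>.\<close>

definition slope :: "real \<Rightarrow> real" where
  "slope t = (\<integral>x. indicator {t..} (T x) * (T x - t0) \<partial>P)"

lemma sets_exp_family [simp, measurable_cong]: "sets (exp_family \<mu> T \<theta>) = sets \<mu>"
  by (simp add: exp_family_def)

lemma space_exp_family [simp]: "space (exp_family \<mu> T \<theta>) = space \<mu>"
  by (simp add: exp_family_def)

lemma integrable_exp:
  assumes "\<theta> \<in> natural_space \<mu> T"
  shows "integrable \<mu> (\<lambda>x. exp (\<theta> * T x))"
  using assms unfolding natural_space_iff by (intro integrableI_nonneg) auto

lemma theta0_in: "\<theta>0 \<in> natural_space \<mu> T"
  using theta0 interior_subset by blast

lemma nn_integral_exp_eq:
  assumes "\<theta> \<in> natural_space \<mu> T"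
  shows "(\<integral>\<^sup>+x. ennreal (exp (\<theta> * T x)) \<partial>\<mu>) = ennreal (partition_fun \<theta>)"
  unfolding partition_fun_def by (rule nn_integral_eq_integral[OF integrable_exp[OF assms]]) auto

text \<open>The base measure cannot be null: every law of the family would then be null and have
  variance zero.\<close>

lemma partition_fun_pos:
  assumes \<theta>: "\<theta> \<in> natural_space \<mu> T"
  shows "partition_fun \<theta> > 0"
proof (rule ccontr)
  assume "\<not> partition_fun \<theta> > 0"
  then have "(\<integral>\<^sup>+x. ennreal (exp (\<theta> * T x)) \<partial>\<mu>) = 0"
    unfolding nn_integral_exp_eq[OF \<theta>] by (simp add: ennreal_eq_0_iff)
  then have "AE x in \<mu>. ennreal (exp (\<theta> * T x)) = 0"
    by (subst (asm) nn_integral_0_iff_AE) auto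
  then have null: "AE x in \<mu>. False" by simp
  have "AE x in P. (T x - t0)\<^sup>2 = 0"
    unfolding exp_family_def by (subst AE_density) (use null in auto)
  then have "var_stat \<mu> T \<theta>0 = 0"
    unfolding var_stat_def by (rule integral_eq_zero_AE)
  with var_pos show False by simp
qed

lemma exp_family_eq:
  assumes \<theta>: "\<theta> \<in> natural_space \<mu> T"
  shows "exp_family \<mu> T \<theta> = density \<mu> (\<lambda>x. ennreal (exp (\<theta> * T x) / partition_fun \<theta>))"
proof -
  have "log_partition \<mu> T \<theta> = ereal (ln (partition_fun \<theta>))"
    using partition_fun_pos[OF \<theta>] by (simp add: log_partition_def Let_def nn_integral_exp_eq[OF \<theta>] ennreal_eq_0_iff)
  then show ?thesis
    using partition_fun_pos[OF \<theta>] by (simp add: exp_family_def exp_diff)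
qed

lemma integral_exp_family:
  fixes f :: "'b \<Rightarrow> real"
  assumes \<theta>: "\<theta> \<in> natural_space \<mu> T" and f [measurable]: "f \<in> borel_measurable \<mu>"
  shows "integral\<^sup>L (exp_family \<mu> T \<theta>) f = (\<integral>x. f x * exp (\<theta> * T x) \<partial>\<mu>) / partition_fun \<theta>"
    and "integrable (exp_family \<mu> T \<theta>) f \<longleftrightarrow> integrable \<mu> (\<lambda>x. f x * exp (\<theta> * T x))"
proof -
  note Z = partition_fun_pos[OF \<theta>]
  have "integral\<^sup>L (exp_family \<mu> T \<theta>) f = (\<integral>x. exp (\<theta> * T x) / partition_fun \<theta> * f x \<partial>\<mu>)"
    unfolding exp_family_eq[OF \<theta>] using Z by (intro integral_real_density) auto
  also have "\<dots> = (\<integral>x. f x * exp (\<theta> * T x) / partition_fun \<theta> \<partial>\<mu>)"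
    by (simp add: mult.commute)
  finally show "integral\<^sup>L (exp_family \<mu> T \<theta>) f = (\<integral>x. f x * exp (\<theta> * T x) \<partial>\<mu>) / partition_fun \<theta>"
    by simp
  have "integrable (exp_family \<mu> T \<theta>) f \<longleftrightarrow> integrable \<mu> (\<lambda>x. exp (\<theta> * T x) / partition_fun \<theta> * f x)"
    unfolding exp_family_eq[OF \<theta>] using Z by (intro integrable_real_density) auto
  also have "(\<lambda>x. exp (\<theta> * T x) / partition_fun \<theta> * f x) = (\<lambda>x. f x * exp (\<theta> * T x) / partition_fun \<theta>)"
    by (simp add: mult.commute)
  also have "integrable \<mu> (\<lambda>x. f x * exp (\<theta> * T x) / partition_fun \<theta>) \<longleftrightarrow> integrable \<mu> (\<lambda>x. f x * exp (\<theta> * T x))"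
  proof
    assume "integrable \<mu> (\<lambda>x. f x * exp (\<theta> * T x) / partition_fun \<theta>)"
    then have "integrable \<mu> (\<lambda>x. f x * exp (\<theta> * T x) / partition_fun \<theta> * partition_fun \<theta>)"
      by (intro integrable_mult_left)
    then show "integrable \<mu> (\<lambda>x. f x * exp (\<theta> * T x))" using Z by simp
  next
    assume "integrable \<mu> (\<lambda>x. f x * exp (\<theta> * T x))"
    then show "integrable \<mu> (\<lambda>x. f x * exp (\<theta> * T x) / partition_fun \<theta>)" by (intro integrable_divide)
  qed
  finally show "integrable (exp_family \<mu> T \<theta>) f \<longleftrightarrow> integrable \<mu> (\<lambda>x. f x * exp (\<theta> * T x))" .
qed

lemma prob_space_exp_family:
  assumes \<theta>: "\<theta> \<in> natural_space \<mu> T"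
  shows "prob_space (exp_family \<mu> T \<theta>)"
proof (rule prob_spaceI)
  note Z = partition_fun_pos[OF \<theta>]
  have "emeasure (exp_family \<mu> T \<theta>) (space (exp_family \<mu> T \<theta>)) = (\<integral>\<^sup>+x. ennreal (exp (\<theta> * T x) / partition_fun \<theta>) \<partial>\<mu>)"
    unfolding exp_family_eq[OF \<theta>] by (subst emeasure_density) (auto intro!: nn_integral_cong)
  also have "\<dots> = ennreal (\<integral>x. exp (\<theta> * T x) / partition_fun \<theta> \<partial>\<mu>)"
    using integrable_exp[OF \<theta>] Z by (intro nn_integral_eq_integral) auto
  also have "\<dots> = 1" using Z by (simp add: partition_fun_def)
  finally show "emeasure (exp_family \<mu> T \<theta>) (space (exp_family \<mu> T \<theta>)) = 1" .
qed

sublocale P: prob_space P by (rule prob_space_exp_family[OF theta0_in])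

lemma prob_space_P: "measure P (space \<mu>) = 1"
  using P.prob_space by simp

lemma tail_eq_integral:
  assumes \<theta>: "\<theta> \<in> natural_space \<mu> T"
  shows "tail t \<theta> = (\<integral>x. indicator {t..} (T x) \<partial>exp_family \<mu> T \<theta>)"
proof -
  have "(\<integral>x. indicator {t..} (T x) \<partial>exp_family \<mu> T \<theta>)
      = (\<integral>x. indicator {x \<in> space \<mu>. t \<le> T x} x \<partial>exp_family \<mu> T \<theta>)"
    by (intro Bochner_Integration.integral_cong) (auto simp: indicator_def)
  also have "\<dots> = tail t \<theta>"
    unfolding tail_prob_def Bochner_Integration.integral_indicator by (rule arg_cong[where f="measure _"]) auto
  finally show ?thesis ..
qed

lemma tail_eq_ratio:
  assumes \<theta>: "\<theta> \<in> natural_space \<mu> T"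
  shows "tail t \<theta> = tail_mass t \<theta> / partition_fun \<theta>"
  unfolding tail_eq_integral[OF \<theta>] tail_mass_def by (rule integral_exp_family(1)[OF \<theta>]) measurable

lemma tail_range:
  assumes \<theta>: "\<theta> \<in> natural_space \<mu> T"
  shows "0 \<le> tail t \<theta>" "tail t \<theta> \<le> 1"
  unfolding tail_prob_def using prob_space.prob_le_1[OF prob_space_exp_family[OF \<theta>]] by auto

lemma tail_antimono:
  assumes \<theta>: "\<theta> \<in> natural_space \<mu> T" and "s \<le> t"
  shows "tail t \<theta> \<le> tail s \<theta>"
proof -
  interpret prob_space "exp_family \<mu> T \<theta>" by (rule prob_space_exp_family[OF \<theta>])
  show ?thesis unfolding tail_prob_def
    using \<open>s \<le> t\<close> by (intro finite_measure_mono) auto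
qed

lemma tail_measurable:
  assumes \<theta>: "\<theta> \<in> natural_space \<mu> T"
  shows "(\<lambda>t. tail t \<theta>) \<in> borel_measurable borel"
proof -
  have "mono (\<lambda>t. - tail t \<theta>)" using tail_antimono[OF \<theta>] by (auto simp: mono_def)
  then have "(\<lambda>t. - (- tail t \<theta>)) \<in> borel_measurable borel"
    by (intro borel_measurable_uminus borel_measurable_mono)
  then show ?thesis by simp
qed

text \<open>Monotone likelihood ratio: raising the parameter by \<open>\<theta>2 - \<theta>1\<close> multiplies the density, up to
  normalization, by a factor that is at least \<open>exp ((\<theta>2 - \<theta>1) * t)\<close> on the event \<open>T \<ge> t\<close> and at most that
  outside it.\<close>

lemma tail_mono:
  assumes \<theta>1: "\<theta>1 \<in> natural_space \<mu> T" and \<theta>2: "\<theta>2 \<in> natural_space \<mu> T" and le: "\<theta>1 \<le> \<theta>2"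
  shows "tail t \<theta>1 \<le> tail t \<theta>2"
proof -
  let ?U = "\<lambda>\<theta> x. indicator {t..} (T x) * exp (\<theta> * T x)"
  let ?L = "\<lambda>\<theta> x. indicator {..<t} (T x) * exp (\<theta> * T x)"
  let ?d = "exp ((\<theta>2 - \<theta>1) * t)"
  have intU: "integrable \<mu> (?U \<theta>)" and intL: "integrable \<mu> (?L \<theta>)"
    if "\<theta> \<in> natural_space \<mu> T" for \<theta>
    by (rule Bochner_Integration.integrable_bound[OF integrable_exp[OF that]],
        auto simp: indicator_def)+
  define L where "L \<theta> = (\<integral>x. ?L \<theta> x \<partial>\<mu>)" for \<theta>
  have split: "partition_fun \<theta> = tail_mass t \<theta> + L \<theta>" if "\<theta> \<in> natural_space \<mu> T" for \<theta>
    unfolding partition_fun_def tail_mass_def L_def Bochner_Integration.integral_add[OF intU[OF that] intL[OF that], symmetric]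
    by (intro Bochner_Integration.integral_cong) (auto simp: indicator_def)
  have shift: "exp (\<theta>2 * T x) = exp ((\<theta>2 - \<theta>1) * T x) * exp (\<theta>1 * T x)" for x
    by (simp add: exp_add[symmetric] algebra_simps)
  have "?d * tail_mass t \<theta>1 = (\<integral>x. ?d * ?U \<theta>1 x \<partial>\<mu>)" by (simp add: tail_mass_def)
  also have "\<dots> \<le> tail_mass t \<theta>2"
    unfolding tail_mass_def using intU[OF \<theta>1] intU[OF \<theta>2] le
    by (intro integral_mono) (auto simp: shift indicator_def intro!: mult_left_mono)
  finally have upper: "?d * tail_mass t \<theta>1 \<le> tail_mass t \<theta>2" .
  have "L \<theta>2 \<le> (\<integral>x. ?d * ?L \<theta>1 x \<partial>\<mu>)"
    unfolding L_def using intL[OF \<theta>1] intL[OF \<theta>2] le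
    by (intro integral_mono) (auto simp: shift indicator_def intro!: mult_left_mono)
  then have lower: "L \<theta>2 \<le> ?d * L \<theta>1" by (simp add: L_def)
  have nonneg: "0 \<le> tail_mass t \<theta>1" "0 \<le> L \<theta>1" by (auto simp: tail_mass_def L_def)
  have "tail_mass t \<theta>1 * L \<theta>2 \<le> tail_mass t \<theta>1 * (?d * L \<theta>1)"
    using lower nonneg by (intro mult_left_mono)
  also have "\<dots> \<le> tail_mass t \<theta>2 * L \<theta>1"
    using mult_right_mono[OF upper nonneg(2)] by (simp add: mult_ac)
  finally have "tail_mass t \<theta>1 * partition_fun \<theta>2 \<le> tail_mass t \<theta>2 * partition_fun \<theta>1"
    by (simp add: split[OF \<theta>1] split[OF \<theta>2] algebra_simps)
  then show ?thesis
    unfolding tail_eq_ratio[OF \<theta>1] tail_eq_ratio[OF \<theta>2]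
    using partition_fun_pos[OF \<theta>1] partition_fun_pos[OF \<theta>2] by (simp add: divide_simps mult.commute)
qed

text \<open>An interior parameter leaves room on both sides, and the tilts by \<open>s\<close> and \<open>- s\<close>
  together dominate \<open>exp (s * \<bar>T\<bar>)\<close>.\<close>

lemma exp_moment:
  obtains s where "s > 0" "\<And>h. \<bar>h\<bar> \<le> s \<Longrightarrow> \<theta>0 + h \<in> natural_space \<mu> T"
    "integrable P (\<lambda>x. exp (s * \<bar>T x - t0\<bar>))"
proof -
  obtain s where s: "s > 0" "cball \<theta>0 s \<subseteq> natural_space \<mu> T"
    using theta0 by (meson mem_interior_cball)
  have nat: "\<theta>0 + h \<in> natural_space \<mu> T" if "\<bar>h\<bar> \<le> s" for h
    using s(2) that by (auto simp: subset_eq dist_real_def)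
  have int: "integrable P (\<lambda>x. exp (h * T x))" if "\<bar>h\<bar> \<le> s" for h
    using integrable_exp[OF nat[OF that]]
    by (subst integral_exp_family(2)[OF theta0_in]) (auto simp: exp_add[symmetric] algebra_simps)
  have "integrable P (\<lambda>x. exp (s * \<bar>t0\<bar>) * (exp (s * T x) + exp (- s * T x)))"
    using s(1) by (intro integrable_mult_right Bochner_Integration.integrable_add int) auto
  then have "integrable P (\<lambda>x. exp (s * \<bar>T x - t0\<bar>))"
  proof (rule Bochner_Integration.integrable_bound)
    have "exp (s * \<bar>T x - t0\<bar>) \<le> exp (s * \<bar>t0\<bar>) * (exp (s * T x) + exp (- s * T x))" for x
    proof -
      have "s * \<bar>T x - t0\<bar> \<le> s * \<bar>t0\<bar> + s * \<bar>T x\<bar>"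
        unfolding distrib_left[symmetric] using s(1) by (intro mult_left_mono) auto
      then have "exp (s * \<bar>T x - t0\<bar>) \<le> exp (s * \<bar>t0\<bar>) * exp (s * \<bar>T x\<bar>)"
        unfolding exp_add[symmetric] by simp
      also have "\<dots> \<le> exp (s * \<bar>t0\<bar>) * (exp (s * T x) + exp (- s * T x))"
        by (intro mult_left_mono) (auto simp: abs_if)
      finally show ?thesis .
    qed
    then show "AE x in P. norm (exp (s * \<bar>T x - t0\<bar>)) \<le> norm (exp (s * \<bar>t0\<bar>) * (exp (s * T x) + exp (- s * T x)))"
      by (auto simp: abs_of_nonneg intro!: AE_I2 mult_nonneg_nonneg)
  qed measurable
  then show ?thesis using that s(1) nat by blast
qed

lemma deviation_moments:
  shows integrable_dev: "integrable P (\<lambda>x. T x - t0)"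
    and integrable_dev2: "integrable P (\<lambda>x. (T x - t0)\<^sup>2)"
    and integral_dev: "(\<integral>x. T x - t0 \<partial>P) = 0"
proof -
  obtain s where s: "s > 0" and int: "integrable P (\<lambda>x. exp (s * \<bar>T x - t0\<bar>))"
    by (rule exp_moment) blast
  show dev: "integrable P (\<lambda>x. T x - t0)"
  proof (rule Bochner_Integration.integrable_bound)
    show "integrable P (\<lambda>x. exp (s * \<bar>T x - t0\<bar>) / s)" using int by auto
    have "\<bar>u\<bar> \<le> exp (s * \<bar>u\<bar>) / s" for u :: real
    proof -
      have "s * \<bar>u\<bar> \<le> exp (s * \<bar>u\<bar>)" using exp_ge_add_one_self[of "s * \<bar>u\<bar>"] by linarith
      then show ?thesis using s by (simp add: pos_le_divide_eq mult.commute)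
    qed
    then show "AE x in P. norm (T x - t0) \<le> norm (exp (s * \<bar>T x - t0\<bar>) / s)"
      using s by auto
  qed measurable
  show "integrable P (\<lambda>x. (T x - t0)\<^sup>2)"
  proof (rule Bochner_Integration.integrable_bound)
    show "integrable P (\<lambda>x. exp (s * \<bar>T x - t0\<bar>) * (2 / s\<^sup>2))" using int by auto
    have "u\<^sup>2 \<le> exp (s * \<bar>u\<bar>) * (2 / s\<^sup>2)" for u :: real
    proof -
      have "(s * \<bar>u\<bar>)\<^sup>2 / 2 \<le> exp (s * \<bar>u\<bar>)"
        using exp_lower_Taylor_quadratic[of "s * \<bar>u\<bar>"] s
        by (smt (verit) mult_nonneg_nonneg abs_ge_zero)
      then show ?thesis using s by (simp add: power_mult_distrib field_simps)
    qed
    then show "AE x in P. norm ((T x - t0)\<^sup>2) \<le> norm (exp (s * \<bar>T x - t0\<bar>) * (2 / s\<^sup>2))"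
      using s by auto
  qed measurable
  have "integrable P (\<lambda>x. (T x - t0) + t0)" using dev by (intro Bochner_Integration.integrable_add) auto
  then show "(\<integral>x. T x - t0 \<partial>P) = 0"
    by (simp add: mean_stat_def prob_space_P)
qed

lemma abs_dev_pos: "J > 0"
proof -
  have "J \<ge> 0" by (simp add: abs_dev_stat_def)
  moreover have "J \<noteq> 0"
  proof
    assume "J = 0"
    then have "AE x in P. \<bar>T x - t0\<bar> = 0"
      unfolding abs_dev_stat_def
      by (subst (asm) integral_nonneg_eq_0_iff_AE) (use integrable_dev in auto)
    then have "AE x in P. (T x - t0)\<^sup>2 = 0" by auto
    then have "var_stat \<mu> T \<theta>0 = 0" unfolding var_stat_def by (rule integral_eq_zero_AE)
    with var_pos show False by simp
  qed
  ultimately show ?thesis by simp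
qed

lemma integrable_ind_mult:
  fixes f :: "'b \<Rightarrow> real"
  assumes "integrable P f"
  shows "integrable P (\<lambda>x. indicator {t..} (T x) * f x)"
  by (rule Bochner_Integration.integrable_bound[OF assms])
     (use borel_measurable_integrable[OF assms] in \<open>auto simp: indicator_def\<close>)

text \<open>The deviation has mean zero, so its positive part carries half of its mean absolute value.\<close>

lemma slope_at_mean: "slope t0 = J / 2"
proof -
  have positive_part: "indicator {t0..} (T x) * (T x - t0) = (1/2) * (T x - t0) + (1/2) * \<bar>T x - t0\<bar>" for x
    by (cases "t0 \<le> T x") (simp_all add: indicator_def field_simps)
  have "slope t0 = (\<integral>x. (1/2) * (T x - t0) + (1/2) * \<bar>T x - t0\<bar> \<partial>P)"
    unfolding slope_def positive_part ..
  also have "\<dots> = (1/2) * (\<integral>x. T x - t0 \<partial>P) + (1/2) * J"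
    unfolding abs_dev_stat_def
    by (subst Bochner_Integration.integral_add) (use integrable_dev in auto)
  finally show ?thesis by (simp add: integral_dev)
qed

text \<open>Only the points with \<open>T\<close> between \<open>t\<close> and the mean contribute to the difference, and there the
  deviation is at most \<open>\<bar>t - t0\<bar>\<close>.\<close>

lemma slope_lipschitz: "\<bar>slope t - J / 2\<bar> \<le> \<bar>t - t0\<bar>"
proof -
  note i = integrable_ind_mult[OF integrable_dev]
  have "\<bar>slope t - J / 2\<bar> \<le> (\<integral>x. \<bar>indicator {t..} (T x) * (T x - t0) - indicator {t0..} (T x) * (T x - t0)\<bar> \<partial>P)"
    unfolding slope_at_mean[symmetric] slope_def Bochner_Integration.integral_diff[OF i i, symmetric]
    by (rule integral_abs_bound)
  also have "\<dots> \<le> (\<integral>x. \<bar>t - t0\<bar> \<partial>P)"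
    by (rule integral_mono') (auto simp: indicator_def)
  finally show ?thesis by (simp add: prob_space_P)
qed

text \<open>Cauchy-Schwarz for the covariance of \<open>T\<close> with the indicator of \<open>T \<ge> t\<close>, proved by
  expanding the residual variance of the indicator after regression on \<open>T\<close>. It is used as a lower bound:
  where the slope is bounded away from zero, so is the Bernoulli variance.\<close>

lemma slope_variance_bound: "(slope t)\<^sup>2 \<le> tail t \<theta>0 * (1 - tail t \<theta>0) * var_stat \<mu> T \<theta>0"
proof -
  let ?V = "\<lambda>x. indicator {t..} (T x) :: real" and ?U = "\<lambda>x. T x - t0"
  define g where "g = tail t \<theta>0"
  define v where "v = var_stat \<mu> T \<theta>0"
  have v: "v > 0" "v = (\<integral>x. (?U x)\<^sup>2 \<partial>P)" using var_pos by (auto simp: v_def var_stat_def)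
  have intV: "integrable P ?V" by (rule P.integrable_const_bound[where B=1]) (auto simp: indicator_def)
  have g: "(\<integral>x. ?V x \<partial>P) = g" by (simp add: g_def tail_eq_integral[OF theta0_in])
  note intVU = integrable_ind_mult[OF integrable_dev, of t]
  \<comment> \<open>The coefficient of the least-squares regression of the indicator on \<open>T\<close>.\<close>
  define l where "l = slope t / v"
  have sq: "(?V x - g - l * ?U x)\<^sup>2
      = (1 - 2 * g) * ?V x + g\<^sup>2 - 2 * l * (?V x * ?U x) + 2 * l * g * ?U x + l\<^sup>2 * (?U x)\<^sup>2" for x
    by (simp add: indicator_def power2_eq_square algebra_simps)
  have "0 \<le> (\<integral>x. (?V x - g - l * ?U x)\<^sup>2 \<partial>P)" by simp
  also have "\<dots> = (1 - 2 * g) * g + g\<^sup>2 - 2 * l * slope t + l\<^sup>2 * v"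
    unfolding sq using intV intVU integrable_dev integrable_dev2
    by (simp add: g prob_space_P integral_dev v(2)[symmetric] slope_def[symmetric])
  also have "\<dots> = g * (1 - g) - (slope t)\<^sup>2 / v"
    using v(1) by (simp add: l_def power2_eq_square field_simps)
  finally show ?thesis using v(1) unfolding g_def[symmetric] v_def[symmetric]
    by (simp add: pos_divide_le_eq)
qed

text \<open>The tail probability at \<open>\<theta>\<^sub>0 + h\<close> is the ratio of the expectations of \<open>V * exp (h * U)\<close> and
  \<open>exp (h * U)\<close> under \<open>\<theta>\<^sub>0\<close>, where \<open>U\<close> is the centred statistic and \<open>V\<close> the indicator of \<open>T \<ge> t\<close>. Centring
  removes the linear term of the denominator, which is therefore \<open>1 + O(h\<^sup>2)\<close>, and bounding \<open>V\<close> by \<open>1\<close> makes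
  the constants independent of \<open>t\<close>.\<close>

lemma tail_expansion:
  obtains r K where "r > 0" "K \<ge> 0" "\<And>h. \<bar>h\<bar> \<le> r \<Longrightarrow> \<theta>0 + h \<in> natural_space \<mu> T"
    "\<And>t h. \<bar>h\<bar> \<le> r \<Longrightarrow> \<bar>tail t (\<theta>0 + h) - tail t \<theta>0 - h * slope t\<bar> \<le> K * h\<^sup>2"
proof -
  obtain s where s: "s > 0" and nat: "\<And>h. \<bar>h\<bar> \<le> s \<Longrightarrow> \<theta>0 + h \<in> natural_space \<mu> T"
    and int: "integrable P (\<lambda>x. exp (s * \<bar>T x - t0\<bar>))"
    by (rule exp_moment) blast
  define r where "r = s / 2"
  have r: "r > 0" "r \<le> s" using s by (auto simp: r_def)
  let ?U = "\<lambda>x. T x - t0"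
  let ?q = "\<lambda>x. (?U x)\<^sup>2 * exp (r * \<bar>?U x\<bar>)"
  have intq: "integrable P ?q"
  proof (rule Bochner_Integration.integrable_bound)
    show "integrable P (\<lambda>x. (2 / r\<^sup>2) * exp (s * \<bar>?U x\<bar>))" using int by auto
    have "u\<^sup>2 * exp (r * \<bar>u\<bar>) \<le> (2 / r\<^sup>2) * exp (s * \<bar>u\<bar>)" for u :: real
    proof -
      have "(r * \<bar>u\<bar>)\<^sup>2 / 2 \<le> exp (r * \<bar>u\<bar>)"
        using exp_lower_Taylor_quadratic[of "r * \<bar>u\<bar>"] r
        by (smt (verit) mult_nonneg_nonneg abs_ge_zero)
      then have "u\<^sup>2 \<le> (2 / r\<^sup>2) * exp (r * \<bar>u\<bar>)" using r by (simp add: power_mult_distrib field_simps)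
      then have "u\<^sup>2 * exp (r * \<bar>u\<bar>) \<le> (2 / r\<^sup>2) * exp (r * \<bar>u\<bar>) * exp (r * \<bar>u\<bar>)"
        by (intro mult_right_mono) auto
      also have "\<dots> = (2 / r\<^sup>2) * exp (s * \<bar>u\<bar>)"
        by (simp add: mult.assoc exp_add[symmetric] r_def)
      finally show ?thesis .
    qed
    then show "AE x in P. norm (?q x) \<le> norm ((2 / r\<^sup>2) * exp (s * \<bar>?U x\<bar>))"
      by auto
  qed measurable
  define K1 where "K1 = integral\<^sup>L P ?q"
  have K1: "K1 \<ge> 0" unfolding K1_def by simp
  have Jnn: "J \<ge> 0" using abs_dev_pos by simp
  have main: "\<bar>tail t (\<theta>0 + h) - tail t \<theta>0 - h * slope t\<bar> \<le> K1 * (2 + r * J) * h\<^sup>2"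
    if h: "\<bar>h\<bar> \<le> r" for t h
  proof -
    let ?V = "\<lambda>x. indicator {t..} (T x) :: real"
    have \<theta>: "\<theta>0 + h \<in> natural_space \<mu> T" using nat h r by auto
    let ?e = "\<lambda>x. exp (h * ?U x)"
    have inte: "integrable P ?e"
    proof (rule Bochner_Integration.integrable_bound[OF int])
      have "h * u \<le> s * \<bar>u\<bar>" for u
      proof -
        have "h * u \<le> \<bar>h\<bar> * \<bar>u\<bar>" by (metis abs_ge_self abs_mult)
        also have "\<dots> \<le> s * \<bar>u\<bar>" using h r by (intro mult_right_mono) auto
        finally show ?thesis .
      qed
      then show "AE x in P. norm (?e x) \<le> norm (exp (s * \<bar>?U x\<bar>))" by auto
    qed measurable
    have intV: "integrable P ?V" by (rule P.integrable_const_bound[where B=1]) (auto simp: indicator_def)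
    note intVe = integrable_ind_mult[OF inte, of t] and intVU = integrable_ind_mult[OF integrable_dev, of t]
    define L where "L = integral\<^sup>L P ?e"
    define A where "A = (\<integral>x. ?V x * ?e x \<partial>P)"
    define g where "g = tail t \<theta>0"
    have g: "(\<integral>x. ?V x \<partial>P) = g" by (simp add: g_def tail_eq_integral[OF theta0_in])
    have g01: "0 \<le> g" "g \<le> 1" using tail_range[OF theta0_in] by (auto simp: g_def)
    have tilt: "(\<integral>x. f x * ?e x \<partial>P) = exp (- h * t0) * (\<integral>x. f x * exp ((\<theta>0 + h) * T x) \<partial>\<mu>) / partition_fun \<theta>0"
      if [measurable]: "f \<in> borel_measurable \<mu>" for f :: "'b \<Rightarrow> real"
    proof -
      have "(\<integral>x. f x * ?e x \<partial>P) = (\<integral>x. f x * ?e x * exp (\<theta>0 * T x) \<partial>\<mu>) / partition_fun \<theta>0"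
        by (rule integral_exp_family(1)[OF theta0_in]) measurable
      also have "(\<lambda>x. f x * ?e x * exp (\<theta>0 * T x)) = (\<lambda>x. exp (- h * t0) * (f x * exp ((\<theta>0 + h) * T x)))"
        by (auto simp: fun_eq_iff exp_add[symmetric] algebra_simps)
      finally show ?thesis by simp
    qed
    have ratio: "tail t (\<theta>0 + h) = A / L"
      using tilt[of ?V] tilt[of "\<lambda>_. 1"] partition_fun_pos[OF theta0_in] partition_fun_pos[OF \<theta>]
      unfolding tail_eq_ratio[OF \<theta>] A_def L_def by (simp add: tail_mass_def partition_fun_def)
    have rem: "\<bar>?e x - 1 - h * ?U x\<bar> \<le> h\<^sup>2 * ?q x" for x
    proof -
      have "\<bar>?e x - 1 - h * ?U x\<bar> \<le> (h * ?U x)\<^sup>2 * exp \<bar>h * ?U x\<bar>" by (rule exp_remainder_bound)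
      also have "\<dots> \<le> (h * ?U x)\<^sup>2 * exp (r * \<bar>?U x\<bar>)"
        using h by (intro mult_left_mono) (auto simp: abs_mult intro!: mult_right_mono)
      finally show ?thesis by (simp add: power_mult_distrib mult_ac)
    qed
    have L_eq: "L - 1 = (\<integral>x. ?e x - 1 - h * ?U x \<partial>P)"
      using inte integrable_dev by (simp add: L_def integral_dev prob_space_P)
    have "\<bar>L - 1\<bar> \<le> (\<integral>x. \<bar>?e x - 1 - h * ?U x\<bar> \<partial>P)"
      unfolding L_eq by (rule integral_abs_bound)
    also have "\<dots> \<le> (\<integral>x. h\<^sup>2 * ?q x \<partial>P)"
    proof (rule integral_mono')
      show "\<bar>?e x - 1 - h * ?U x\<bar> \<le> h\<^sup>2 * ?q x" for x by (rule rem)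
      show "integrable P (\<lambda>x. h\<^sup>2 * ?q x)" by (rule integrable_mult_right[OF intq])
    qed simp
    finally have L1: "\<bar>L - 1\<bar> \<le> K1 * h\<^sup>2" by (simp add: K1_def mult.commute)
    have A_eq: "A - g - h * slope t = (\<integral>x. ?V x * ?e x - ?V x - h * (?V x * ?U x) \<partial>P)"
      using intVe intV intVU by (simp add: A_def g slope_def)
    have "\<bar>A - g - h * slope t\<bar> \<le> (\<integral>x. \<bar>?V x * ?e x - ?V x - h * (?V x * ?U x)\<bar> \<partial>P)"
      unfolding A_eq by (rule integral_abs_bound)
    also have "\<dots> \<le> (\<integral>x. h\<^sup>2 * ?q x \<partial>P)"
    proof (rule integral_mono')
      show "\<bar>?V x * ?e x - ?V x - h * (?V x * ?U x)\<bar> \<le> h\<^sup>2 * ?q x" for x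
        using rem[of x] by (cases "t \<le> T x") (simp_all add: indicator_def)
      show "integrable P (\<lambda>x. h\<^sup>2 * ?q x)" by (rule integrable_mult_right[OF intq])
    qed simp
    finally have A1: "\<bar>A - g - h * slope t\<bar> \<le> K1 * h\<^sup>2" by (simp add: K1_def mult.commute)
    have "1 \<le> L"
    proof -
      have "(\<integral>x. 1 + h * ?U x \<partial>P) \<le> L"
        unfolding L_def using inte integrable_dev by (intro integral_mono) auto
      then show ?thesis using integrable_dev by (simp add: integral_dev prob_space_P)
    qed
    have "\<bar>slope t\<bar> \<le> (\<integral>x. \<bar>?V x * ?U x\<bar> \<partial>P)" unfolding slope_def by (rule integral_abs_bound)
    also have "\<dots> \<le> J" unfolding abs_dev_stat_def
      using integrable_dev by (intro integral_mono') (auto simp: indicator_def)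
    finally have "\<bar>h * slope t\<bar> \<le> r * J"
      unfolding abs_mult using h by (intro mult_mono) auto
    then have lin: "\<bar>g + h * slope t\<bar> \<le> 1 + r * J" using g01 by linarith
    have "\<bar>tail t (\<theta>0 + h) - g - h * slope t\<bar> = \<bar>A - L * (g + h * slope t)\<bar> / L"
      unfolding ratio using \<open>1 \<le> L\<close> by (simp add: field_simps flip: abs_divide) (simp add: field_simps abs_divide)
    also have "\<dots> \<le> \<bar>A - L * (g + h * slope t)\<bar>"
      using \<open>1 \<le> L\<close> by (simp add: divide_le_eq mult_le_cancel_left1)
    also have "\<dots> = \<bar>(A - g - h * slope t) - (L - 1) * (g + h * slope t)\<bar>"
      by (simp add: algebra_simps)
    also have "\<dots> \<le> \<bar>A - g - h * slope t\<bar> + \<bar>L - 1\<bar> * \<bar>g + h * slope t\<bar>"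
      unfolding abs_mult[symmetric] by (rule abs_triangle_ineq4)
    also have "\<dots> \<le> K1 * h\<^sup>2 + (K1 * h\<^sup>2) * (1 + r * J)"
      using K1 by (intro add_mono A1 mult_mono L1 lin) auto
    finally show ?thesis by (simp add: g_def algebra_simps)
  qed
  show ?thesis
    by (rule that[of r "K1 * (2 + r * J)"]) (use r nat K1 Jnn main in auto)
qed

end

section \<open>The inverse of the tail probability\<close>

text \<open>The maximum, if there is one, is kept; every other element is exceeded by an element picked
  above some rational number.\<close>

lemma countable_cofinal_subset:
  fixes A :: "real set"
  shows "\<exists>C\<subseteq>A. countable C \<and> (\<forall>a\<in>A. \<exists>c\<in>C. a \<le> c)"
proof -
  define pick where "pick q = (SOME a. a \<in> A \<and> q < a)" for q :: real
  have pick: "pick q \<in> A" "q < pick q" if "\<exists>a\<in>A. q < a" for q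
    using someI_ex[of "\<lambda>a. a \<in> A \<and> q < a"] that unfolding pick_def by auto
  define Q where "Q = {q \<in> \<rat>. \<exists>a\<in>A. q < a}"
  define Mx where "Mx = {a \<in> A. \<forall>b\<in>A. b \<le> a}"
  have "a = b" if "a \<in> Mx" "b \<in> Mx" for a b
    using that unfolding Mx_def by (auto intro: order_antisym)
  then have "Mx \<subseteq> {SOME a. a \<in> Mx}" by (metis singletonI someI subsetI)
  then have "countable Mx" by (rule countable_subset) simp
  moreover have "countable Q"
    unfolding Q_def by (rule countable_subset[OF _ countable_rat]) auto
  moreover have "\<exists>c\<in>pick ` Q \<union> Mx. a \<le> c" if aA: "a \<in> A" for a
  proof (cases "a \<in> Mx")
    case False
    then obtain b where b: "b \<in> A" "a < b" using aA by (auto simp: Mx_def not_le)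
    obtain q where q: "q \<in> \<rat>" "a < q" "q < b" using Rats_dense_in_real[OF b(2)] by auto
    then have "q \<in> Q" using b by (auto simp: Q_def)
    then have "a \<le> pick q" using pick(2)[of q] q b by (auto simp: Q_def)
    then show ?thesis using \<open>q \<in> Q\<close> by auto
  qed auto
  ultimately show ?thesis
    by (intro exI[of _ "pick ` Q \<union> Mx"]) (auto simp: Q_def Mx_def intro!: pick(1))
qed

lemma countable_coinitial_subset:
  fixes A :: "real set"
  shows "\<exists>C\<subseteq>A. countable C \<and> (\<forall>a\<in>A. \<exists>c\<in>C. c \<le> a)"
proof -
  obtain C where C: "C \<subseteq> uminus ` A" "countable C" "\<And>a. a \<in> uminus ` A \<Longrightarrow> \<exists>c\<in>C. a \<le> c"
    using countable_cofinal_subset[of "uminus ` A"] by blast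
  have "uminus ` C \<subseteq> A" using C(1) by auto
  moreover have "\<exists>c\<in>uminus ` C. c \<le> a" if "a \<in> A" for a
    using C(3)[of "- a"] that by force
  ultimately show ?thesis using C(2) by (intro exI[of _ "uminus ` C"]) auto
qed

context nondegenerate_exp_family
begin

text \<open>By monotonicity in the parameter, the quantifiers over the natural parameter space may be
  restricted to countable coinitial or cofinal subsets. For each fixed parameter the tail probability is
  monotone in \<open>t\<close> and hence measurable.\<close>

lemma tail_inverse_measurable:
  "(\<lambda>x. tail_inverse \<mu> T (fst x) (snd x)) \<in> borel_measurable (borel \<Otimes>\<^sub>M borel)"
proof (rule borel_measurableI_less)
  fix y :: ereal
  let ?\<Theta> = "natural_space \<mu> T"
  obtain C where C: "C \<subseteq> ?\<Theta>" "countable C" "\<And>a. a \<in> ?\<Theta> \<Longrightarrow> \<exists>c\<in>C. c \<le> a"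
    using countable_coinitial_subset[of ?\<Theta>] by blast
  obtain D where D: "D \<subseteq> {\<theta> \<in> ?\<Theta>. ereal \<theta> < y}" "countable D"
      "\<And>a. a \<in> {\<theta> \<in> ?\<Theta>. ereal \<theta> < y} \<Longrightarrow> \<exists>c\<in>D. a \<le> c"
    using countable_cofinal_subset[of "{\<theta> \<in> ?\<Theta>. ereal \<theta> < y}"] by blast
  have below: "(\<forall>\<theta>\<in>?\<Theta>. p < tail t \<theta>) \<longleftrightarrow> (\<forall>\<theta>\<in>C. p < tail t \<theta>)" for p t
    using C tail_mono by (meson less_le_trans subsetD)
  have exceeds: "(\<exists>\<theta>\<in>?\<Theta>. ereal \<theta> < y \<and> p \<le> tail t \<theta>) \<longleftrightarrow> (\<exists>\<theta>\<in>D. p \<le> tail t \<theta>)" for p t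
  proof
    assume "\<exists>\<theta>\<in>?\<Theta>. ereal \<theta> < y \<and> p \<le> tail t \<theta>"
    then obtain \<theta> where \<theta>: "\<theta> \<in> ?\<Theta>" "ereal \<theta> < y" "p \<le> tail t \<theta>" by blast
    then obtain c where "c \<in> D" "\<theta> \<le> c" using D(3) by blast
    then show "\<exists>\<theta>\<in>D. p \<le> tail t \<theta>"
      using tail_mono[of \<theta> c t] \<theta> D(1) by (intro bexI[of _ c]) auto
  qed (use D(1) in auto)
  have iff: "tail_inverse \<mu> T p t < y \<longleftrightarrow>
      (if \<forall>\<theta>\<in>C. p < tail t \<theta> then - \<infinity> < y else \<exists>\<theta>\<in>D. p \<le> tail t \<theta>)" for p t
    unfolding tail_inverse_def below exceeds[symmetric] by (auto simp: Inf_less_iff)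
  have [measurable]: "Measurable.pred (borel \<Otimes>\<^sub>M borel) (\<lambda>x. \<forall>\<theta>\<in>C. fst x < tail (snd x) \<theta>)"
    and [measurable]: "Measurable.pred (borel \<Otimes>\<^sub>M borel) (\<lambda>x. \<exists>\<theta>\<in>D. fst x \<le> tail (snd x) \<theta>)"
  proof -
    have [measurable]: "(\<lambda>x. tail (snd x) \<theta>) \<in> borel_measurable (borel \<Otimes>\<^sub>M borel)"
      if "\<theta> \<in> ?\<Theta>" for \<theta>
      using measurable_compose[OF measurable_snd tail_measurable[OF that]] .
    have lt: "{x \<in> space (borel \<Otimes>\<^sub>M borel). fst x < tail (snd x) \<theta>} \<in> sets (borel \<Otimes>\<^sub>M borel)"
      and le: "{x \<in> space (borel \<Otimes>\<^sub>M borel). fst x \<le> tail (snd x) \<theta>} \<in> sets (borel \<Otimes>\<^sub>M borel)"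
      if "\<theta> \<in> ?\<Theta>" for \<theta>
      using that by measurable
    show "Measurable.pred (borel \<Otimes>\<^sub>M borel) (\<lambda>x. \<forall>\<theta>\<in>C. fst x < tail (snd x) \<theta>)"
      unfolding pred_def by (intro sets.sets_Collect_countable_All' C(2) lt) (use C(1) in blast)
    show "Measurable.pred (borel \<Otimes>\<^sub>M borel) (\<lambda>x. \<exists>\<theta>\<in>D. fst x \<le> tail (snd x) \<theta>)"
      unfolding pred_def by (intro sets.sets_Collect_countable_Ex' D(2) le) (use D(1) in blast)
  qed
  show "{x \<in> space (borel \<Otimes>\<^sub>M borel). tail_inverse \<mu> T (fst x) (snd x) < y} \<in> sets (borel \<Otimes>\<^sub>M borel)"
    unfolding iff by measurable
qed

lemma tail_inverse_between:
  assumes l: "l \<in> natural_space \<mu> T" "tail t l < p" and u: "u \<in> natural_space \<mu> T" "p \<le> tail t u"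
  shows "ereal l \<le> tail_inverse \<mu> T p t" "tail_inverse \<mu> T p t \<le> ereal u"
proof -
  have eq: "tail_inverse \<mu> T p t = Inf (ereal ` {\<theta> \<in> natural_space \<mu> T. p \<le> tail t \<theta>})"
    using l by (auto simp: tail_inverse_def)
  show "tail_inverse \<mu> T p t \<le> ereal u"
    unfolding eq using u by (intro INF_lower) auto
  have "l \<le> \<theta>" if "\<theta> \<in> natural_space \<mu> T" "p \<le> tail t \<theta>" for \<theta>
    using tail_mono[OF that(1) l(1), of t] that(2) l(2) by (cases "l \<le> \<theta>") auto
  then show "ereal l \<le> tail_inverse \<mu> T p t"
    unfolding eq by (intro INF_greatest) auto
qed

text \<open>Let \<open>S = sqrt n * (p - tail t \<theta>0)\<close>. At \<open>\<theta>0 + (2 * S / J \<plusminus> \<eta>) / sqrt n\<close> the tail probability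
  differs from the level \<open>p\<close> by about \<open>\<plusminus> J * \<eta> / (2 * sqrt n)\<close>. For \<open>t\<close> close to the mean and \<open>n\<close>
  large the errors of the linearization are smaller than that, uniformly in \<open>t\<close> and in bounded \<open>S\<close>, so these two
  points enclose the inverse.\<close>

lemma tail_inverse_expansion:
  assumes B: "B \<ge> 0" and \<eta>: "\<eta> > 0"
  obtains \<kappa> and n0 :: nat where "\<kappa> > 0"
    "\<And>n t p. n \<ge> n0 \<Longrightarrow> \<bar>t - t0\<bar> \<le> \<kappa> \<Longrightarrow> \<bar>sqrt (real n) * (p - tail t \<theta>0)\<bar> \<le> B \<Longrightarrow>
      \<bar>ereal (sqrt (real n)) * (tail_inverse \<mu> T p t - ereal \<theta>0)
        - ereal (2 * inverse J * (sqrt (real n) * (p - tail t \<theta>0)))\<bar> \<le> ereal \<eta>"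
proof -
  define a where "a = J / 2"
  have a: "a > 0" using abs_dev_pos by (simp add: a_def)
  define B' where "B' = B / a + \<eta>"
  have B': "B' > 0" using B a \<eta> by (auto simp: B'_def intro: add_nonneg_pos)
  obtain r K where r: "r > 0" and K: "K \<ge> 0" and nat: "\<And>h. \<bar>h\<bar> \<le> r \<Longrightarrow> \<theta>0 + h \<in> natural_space \<mu> T"
    and expand: "\<And>t h. \<bar>h\<bar> \<le> r \<Longrightarrow> \<bar>tail t (\<theta>0 + h) - tail t \<theta>0 - h * slope t\<bar> \<le> K * h\<^sup>2"
    by (rule tail_expansion) blast
  \<comment> \<open>With \<open>h = y / sqrt n\<close> and \<open>\<bar>y\<bar> \<le> B'\<close>, both the variation of the slope and the quadratic
    remainder must cost at most a quarter of the margin \<open>a * \<eta>\<close>; the first condition fixes \<open>\<kappa>\<close>,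
    the second enters the choice of \<open>n0\<close>.\<close>
  define \<kappa> where "\<kappa> = a * \<eta> / (4 * B')"
  have \<kappa>: "\<kappa> > 0" "B' * \<kappa> = a * \<eta> / 4" using a \<eta> B' by (auto simp: \<kappa>_def)
  obtain n0 :: nat where n0: "real n0 \<ge> (max 1 (max (B' / r) (4 * K * B'\<^sup>2 / (a * \<eta>))))\<^sup>2"
    by (meson real_arch_simple)
  have approx: "\<bar>ereal (sqrt (real n)) * (tail_inverse \<mu> T p t - ereal \<theta>0)
      - ereal (2 * inverse J * (sqrt (real n) * (p - tail t \<theta>0)))\<bar> \<le> ereal \<eta>"
    if n: "n \<ge> n0" and t: "\<bar>t - t0\<bar> \<le> \<kappa>" and S: "\<bar>sqrt (real n) * (p - tail t \<theta>0)\<bar> \<le> B" for n t p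
  proof -
    define w where "w = sqrt (real n)"
    define S' where "S' = w * (p - tail t \<theta>0)"
    have "max 1 (max (B' / r) (4 * K * B'\<^sup>2 / (a * \<eta>))) \<le> w"
      unfolding w_def
    proof (rule real_le_rsqrt)
      have "real n0 \<le> real n" using n by simp
      with n0 show "(max 1 (max (B' / r) (4 * K * B'\<^sup>2 / (a * \<eta>))))\<^sup>2 \<le> real n" by (rule order_trans)
    qed
    then have w: "1 \<le> w" "B' / r \<le> w" "4 * K * B'\<^sup>2 / (a * \<eta>) \<le> w" by auto
    have w0: "w > 0" using w(1) by simp
    have lin: "\<theta>0 + y / w \<in> natural_space \<mu> T \<and> \<bar>w * (tail t (\<theta>0 + y / w) - tail t \<theta>0) - y * a\<bar> \<le> a * \<eta> / 2"
      if y: "\<bar>y\<bar> \<le> B'" for y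
    proof -
      have "\<bar>y / w\<bar> \<le> B' / w" using y w0 by (simp add: divide_right_mono)
      also have "\<dots> \<le> r" using w(2) w0 r by (simp add: field_simps)
      finally have h: "\<bar>y / w\<bar> \<le> r" .
      have "w * \<bar>tail t (\<theta>0 + y / w) - tail t \<theta>0 - y / w * slope t\<bar> \<le> w * (K * (y / w)\<^sup>2)"
        using expand[OF h] w0 by (intro mult_left_mono) auto
      also have "\<dots> = K * y\<^sup>2 / w" using w0 by (simp add: power2_eq_square)
      also have "\<dots> \<le> K * B'\<^sup>2 / w"
        using y K w0 B' by (intro divide_right_mono mult_left_mono) (auto simp: abs_le_square_iff[symmetric])
      also have "\<dots> \<le> a * \<eta> / 4"
        using w(3) w0 a \<eta> by (simp add: field_simps)
      finally have e: "w * \<bar>tail t (\<theta>0 + y / w) - tail t \<theta>0 - y / w * slope t\<bar> \<le> a * \<eta> / 4" .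
      have "w * (tail t (\<theta>0 + y / w) - tail t \<theta>0) - y * slope t
          = w * (tail t (\<theta>0 + y / w) - tail t \<theta>0 - y / w * slope t)"
        using w0 by (simp add: right_diff_distrib)
      then have e1: "\<bar>w * (tail t (\<theta>0 + y / w) - tail t \<theta>0) - y * slope t\<bar> \<le> a * \<eta> / 4"
        using e w0 by (simp only: abs_mult abs_of_pos)
      have "\<bar>y * slope t - y * a\<bar> = \<bar>y\<bar> * \<bar>slope t - a\<bar>"
        by (simp add: abs_mult[symmetric] right_diff_distrib)
      also have "\<dots> \<le> B' * \<kappa>"
        using y slope_lipschitz[of t] t B' by (intro mult_mono) (auto simp: a_def)
      finally have e2: "\<bar>y * slope t - y * a\<bar> \<le> a * \<eta> / 4" using \<kappa> by simp
      show ?thesis using nat[OF h] e1 e2 by linarith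
    qed
    have Sa: "\<bar>S' / a\<bar> \<le> B / a"
      using S a by (simp add: S'_def w_def divide_right_mono)
    have yl: "\<bar>S' / a - \<eta>\<bar> \<le> B'" and yu: "\<bar>S' / a + \<eta>\<bar> \<le> B'"
      using Sa \<eta> unfolding B'_def by linarith+
    have pos: "a * \<eta> > 0" using a \<eta> by simp
    have "w * (tail t (\<theta>0 + (S' / a - \<eta>) / w) - tail t \<theta>0) < S'"
    proof -
      have "(S' / a - \<eta>) * a = S' - a * \<eta>" using a by (simp add: field_simps)
      then show ?thesis using conjunct2[OF lin[OF yl]] pos by linarith
    qed
    then have lower: "tail t (\<theta>0 + (S' / a - \<eta>) / w) < p"
      using w0 by (simp add: S'_def)
    have "w * (tail t (\<theta>0 + (S' / a + \<eta>) / w) - tail t \<theta>0) > S'"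
    proof -
      have "(S' / a + \<eta>) * a = S' + a * \<eta>" using a by (simp add: field_simps)
      then show ?thesis using conjunct2[OF lin[OF yu]] pos by linarith
    qed
    then have upper: "p \<le> tail t (\<theta>0 + (S' / a + \<eta>) / w)"
      using w0 by (simp add: S'_def)
    note between = tail_inverse_between[OF conjunct1[OF lin[OF yl]] lower conjunct1[OF lin[OF yu]] upper]
    then obtain \<theta> where \<theta>: "tail_inverse \<mu> T p t = ereal \<theta>"
      by (cases "tail_inverse \<mu> T p t") auto
    have "\<theta>0 + (S' / a - \<eta>) / w \<le> \<theta>" "\<theta> \<le> \<theta>0 + (S' / a + \<eta>) / w"
      using between \<theta> by auto
    then have "\<bar>w * (\<theta> - \<theta>0) - S' / a\<bar> \<le> \<eta>"
      using w0 by (simp add: abs_le_iff field_simps)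
    then show ?thesis
      unfolding \<theta> w_def[symmetric] S'_def[symmetric]
      using abs_dev_pos by (simp add: a_def field_simps)
  qed
  show ?thesis by (rule that[OF \<kappa>(1) approx])
qed

end

section \<open>Randomized response\<close>

definition response_noise :: "real \<Rightarrow> bool \<Rightarrow> real" where
  "response_noise \<epsilon> k = (if k then 1 else - exp \<epsilon>) / (exp \<epsilon> - 1)"

text \<open>The noise enters through a sign determined by the true bit, multiplied by a variable that
  depends on the coin only.\<close>

lemma debias_rand_response:
  assumes "\<epsilon> > 0"
  shows "debias \<epsilon> (rand_response k v) = v + (2 * v - 1) * response_noise \<epsilon> k"
proof -
  define e where "e = exp \<epsilon>"
  have e: "e > 1" using assms by (simp add: e_def)
  have affine: "debias \<epsilon> w = ((e + 1) * w - 1) / (e - 1)" for w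
    using e unfolding debias_def e_def[symmetric] by (simp add: right_diff_distrib diff_divide_distrib)
  have "v = v * (e - 1) / (e - 1)" using e by simp
  then have "v + (2 * v - 1) * response_noise \<epsilon> k = (v * (e - 1) + (2 * v - 1) * (if k then 1 else - e)) / (e - 1)"
    unfolding response_noise_def e_def[symmetric] add_divide_distrib by simp
  also have "v * (e - 1) + (2 * v - 1) * (if k then 1 else - e) = (e + 1) * rand_response k v - 1"
    by (simp add: rand_response_def algebra_simps)
  finally show ?thesis unfolding affine ..
qed

lemma response_noise_moments:
  assumes "\<epsilon> > 0"
  shows "keep_prob \<epsilon> * response_noise \<epsilon> True + (1 - keep_prob \<epsilon>) * response_noise \<epsilon> False = 0"
    and "keep_prob \<epsilon> * (response_noise \<epsilon> True)\<^sup>2 + (1 - keep_prob \<epsilon>) * (response_noise \<epsilon> False)\<^sup>2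
      = exp \<epsilon> / (exp \<epsilon> - 1)\<^sup>2"
    and "\<bar>response_noise \<epsilon> k\<bar> \<le> exp \<epsilon> / (exp \<epsilon> - 1)"
proof -
  define e where "e = exp \<epsilon>"
  have e: "e > 1" using assms by (simp add: e_def)
  have kp: "1 - e / (e + 1) = 1 / (e + 1)" using e by (simp add: field_simps)
  show "keep_prob \<epsilon> * response_noise \<epsilon> True + (1 - keep_prob \<epsilon>) * response_noise \<epsilon> False = 0"
    unfolding keep_prob_def response_noise_def e_def[symmetric] kp by simp
  have "e / (e + 1) * (1 / (e - 1))\<^sup>2 + 1 / (e + 1) * (- e / (e - 1))\<^sup>2 = (e + e\<^sup>2) / ((e + 1) * (e - 1)\<^sup>2)"
    by (simp add: power_divide add_divide_distrib)
  also have "\<dots> = (e * (e + 1)) / ((e + 1) * (e - 1)\<^sup>2)"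
    by (simp add: power2_eq_square algebra_simps)
  also have "\<dots> = e / (e - 1)\<^sup>2" using e by simp
  finally show "keep_prob \<epsilon> * (response_noise \<epsilon> True)\<^sup>2 + (1 - keep_prob \<epsilon>) * (response_noise \<epsilon> False)\<^sup>2
      = exp \<epsilon> / (exp \<epsilon> - 1)\<^sup>2"
    unfolding keep_prob_def response_noise_def e_def[symmetric] kp by simp
  show "\<bar>response_noise \<epsilon> k\<bar> \<le> exp \<epsilon> / (exp \<epsilon> - 1)"
    unfolding response_noise_def e_def[symmetric] using e by (auto simp: divide_right_mono)
qed

lemma keep_prob_range: "0 < keep_prob \<epsilon>" "keep_prob \<epsilon> < 1"
  by (auto simp: keep_prob_def add_pos_pos divide_less_eq)

lemma distr_bernoulli:
  assumes M: "prob_space M" and k [measurable]: "k \<in> M \<rightarrow>\<^sub>M count_space UNIV"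
    and p: "measure M {\<omega> \<in> space M. k \<omega>} = p"
  shows "distr M (count_space UNIV) k = measure_pmf (bernoulli_pmf p)"
proof -
  interpret prob_space M by (rule M)
  have p01: "0 \<le> p" "p \<le> 1" using p by auto
  have neg: "measure M {\<omega> \<in> space M. \<not> k \<omega>} = 1 - p"
    using prob_neg[of k] p by simp
  show ?thesis
  proof (rule measure_eqI_finite[where A=UNIV])
    fix b :: bool
    have "k -` {b} \<inter> space M = {\<omega> \<in> space M. if b then k \<omega> else \<not> k \<omega>}" by auto
    then have "emeasure (distr M (count_space UNIV) k) {b} = ennreal (if b then p else 1 - p)"
      by (subst emeasure_distr) (use p neg in \<open>auto simp: emeasure_eq_measure\<close>)
    also have "\<dots> = emeasure (measure_pmf (bernoulli_pmf p)) {b}"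
      using p01 by (cases b) (auto simp: emeasure_pmf_single)
    finally show "emeasure (distr M (count_space UNIV) k) {b} = emeasure (measure_pmf (bernoulli_pmf p)) {b}" .
  qed auto
qed

context nondegenerate_exp_family
begin

text \<open>One summand of the linear combination with coefficients \<open>a\<close> and \<open>b\<close> of the privacy term and the
  standardized sampling term, as a function of the cut point, the observation and the coin.\<close>

definition score :: "real \<Rightarrow> real \<Rightarrow> real \<Rightarrow> real \<Rightarrow> 'b \<times> bool \<Rightarrow> real" where
  "score \<epsilon> a b t = (\<lambda>(x, k).
     a * ((2 * of_bool (T x \<ge> t) - 1) * response_noise \<epsilon> k)
     + b * ((of_bool (T x \<ge> t) - tail t \<theta>0) / sqrt (tail t \<theta>0 * (1 - tail t \<theta>0))))"

lemma score_measurable: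
  "case_prod (score \<epsilon> a b) \<in> borel_measurable (borel \<Otimes>\<^sub>M (\<mu> \<Otimes>\<^sub>M count_space UNIV))"
proof -
  have [measurable]: "(\<lambda>t. tail t \<theta>0) \<in> borel_measurable borel" by (rule tail_measurable[OF theta0_in])
  have [measurable]: "response_noise \<epsilon> \<in> borel_measurable (count_space UNIV)" by simp
  show ?thesis unfolding score_def of_bool_def case_prod_beta by measurable
qed

text \<open>The coin is independent of the observation and its noise is centred, so the cross term
  vanishes; as \<open>(2 V - 1)\<^sup>2 = 1\<close>, the privacy part has the same variance for every cut point.\<close>

lemma score_moments:
  assumes eps: "\<epsilon> > 0" and g: "0 < tail t \<theta>0 * (1 - tail t \<theta>0)"
  defines "Q \<equiv> P \<Otimes>\<^sub>M measure_pmf (bernoulli_pmf (keep_prob \<epsilon>))"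
  shows "(\<integral>p. score \<epsilon> a b t p \<partial>Q) = 0"
    and "(\<integral>p. (score \<epsilon> a b t p)\<^sup>2 \<partial>Q) = a\<^sup>2 * (exp \<epsilon> / (exp \<epsilon> - 1)\<^sup>2) + b\<^sup>2"
    and "\<bar>score \<epsilon> a b t p\<bar> \<le> \<bar>a\<bar> * (exp \<epsilon> / (exp \<epsilon> - 1)) + \<bar>b\<bar> / sqrt (tail t \<theta>0 * (1 - tail t \<theta>0))"
proof -
  define G where "G = tail t \<theta>0"
  define \<sigma> where "\<sigma> = sqrt (G * (1 - G))"
  have \<sigma>: "\<sigma> > 0" "\<sigma>\<^sup>2 = G * (1 - G)" using g by (auto simp: \<sigma>_def G_def)
  have G01: "0 \<le> G" "G \<le> 1" using tail_range[OF theta0_in] by (auto simp: G_def)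
  define V :: "'b \<Rightarrow> real" where "V x = of_bool (T x \<ge> t)" for x
  have V01: "V x = 0 \<or> V x = 1" for x by (simp add: V_def)
  have V_ind: "V = (\<lambda>x. indicator {t..} (T x))" by (auto simp: V_def fun_eq_iff)
  have [measurable]: "V \<in> borel_measurable \<mu>" unfolding V_ind by measurable
  have sc: "score \<epsilon> a b t (x, k) = a * ((2 * V x - 1) * response_noise \<epsilon> k) + b * ((V x - G) / \<sigma>)" for x k
    by (simp add: score_def V_def G_def \<sigma>_def)
  show bnd: "\<bar>score \<epsilon> a b t p\<bar> \<le> \<bar>a\<bar> * (exp \<epsilon> / (exp \<epsilon> - 1)) + \<bar>b\<bar> / sqrt (tail t \<theta>0 * (1 - tail t \<theta>0))" for p
  proof -
    obtain x k where p: "p = (x, k)" by (cases p)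
    have "\<bar>a * ((2 * V x - 1) * response_noise \<epsilon> k)\<bar> = \<bar>a\<bar> * \<bar>response_noise \<epsilon> k\<bar>"
      using V01[of x] by (auto simp: abs_mult)
    also have "\<dots> \<le> \<bar>a\<bar> * (exp \<epsilon> / (exp \<epsilon> - 1))"
      by (intro mult_left_mono response_noise_moments(3) eps) auto
    finally have b1: "\<bar>a * ((2 * V x - 1) * response_noise \<epsilon> k)\<bar> \<le> \<bar>a\<bar> * (exp \<epsilon> / (exp \<epsilon> - 1))" .
    have "\<bar>V x - G\<bar> \<le> 1" using V01[of x] G01 by auto
    then have "\<bar>b\<bar> * \<bar>V x - G\<bar> / \<sigma> \<le> \<bar>b\<bar> * 1 / \<sigma>"
      using \<sigma> by (intro divide_right_mono mult_left_mono) auto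
    then have b2: "\<bar>b * ((V x - G) / \<sigma>)\<bar> \<le> \<bar>b\<bar> / \<sigma>"
      using \<sigma> by (simp add: abs_mult)
    show ?thesis
      unfolding p sc G_def[symmetric] \<sigma>_def[symmetric]
      by (rule order_trans[OF abs_triangle_ineq add_mono[OF b1 b2]])
  qed
  define C where "C = \<bar>a\<bar> * (exp \<epsilon> / (exp \<epsilon> - 1)) + \<bar>b\<bar> / sqrt (tail t \<theta>0 * (1 - tail t \<theta>0))"
  let ?B = "measure_pmf (bernoulli_pmf (keep_prob \<epsilon>))"
  interpret PB: pair_prob_space P ?B ..
  have sets_PB [measurable_cong]: "sets (P \<Otimes>\<^sub>M ?B) = sets (\<mu> \<Otimes>\<^sub>M count_space UNIV)"
    by (intro sets_pair_measure_cong) auto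
  have [measurable]: "score \<epsilon> a b t \<in> borel_measurable (P \<Otimes>\<^sub>M ?B)"
    using measurable_compose[OF measurable_Pair1'[of t borel "\<mu> \<Otimes>\<^sub>M count_space UNIV"] score_measurable[of \<epsilon> a b]]
    by (simp cong: measurable_cong_sets add: sets_PB)
  have int1: "integrable (P \<Otimes>\<^sub>M ?B) (score \<epsilon> a b t)"
    by (rule PB.P.integrable_const_bound[where B=C]) (use bnd in \<open>auto simp: C_def\<close>)
  have int2: "integrable (P \<Otimes>\<^sub>M ?B) (\<lambda>p. (score \<epsilon> a b t p)\<^sup>2)"
  proof (rule PB.P.integrable_const_bound[where B="C\<^sup>2"])
    show "AE p in P \<Otimes>\<^sub>M ?B. norm ((score \<epsilon> a b t p)\<^sup>2) \<le> C\<^sup>2"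
    proof (intro AE_I2)
      fix p
      have "\<bar>score \<epsilon> a b t p\<bar>\<^sup>2 \<le> C\<^sup>2" unfolding C_def by (intro power_mono bnd) simp
      then show "norm ((score \<epsilon> a b t p)\<^sup>2) \<le> C\<^sup>2" by simp
    qed
  qed measurable
  have intV: "integrable P V"
    by (rule P.integrable_const_bound[where B=1]) (auto simp: V_ind indicator_def)
  have EV: "(\<integral>x. V x \<partial>P) = G"
    unfolding V_ind G_def by (rule tail_eq_integral[OF theta0_in, symmetric])
  note kp = keep_prob_range[of \<epsilon>]
  note nm = response_noise_moments[OF eps]
  have "(\<integral>p. score \<epsilon> a b t p \<partial>(P \<Otimes>\<^sub>M ?B)) = (\<integral>x. (\<integral>k. score \<epsilon> a b t (x, k) \<partial>?B) \<partial>P)"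
    by (rule PB.integral_fst'[OF int1, symmetric])
  also have "\<dots> = (\<integral>x. b / \<sigma> * (V x - G) \<partial>P)"
  proof (intro Bochner_Integration.integral_cong refl)
    fix x
    let ?n1 = "response_noise \<epsilon> True" and ?n0 = "response_noise \<epsilon> False" and ?p = "keep_prob \<epsilon>"
    define y where "y = b * ((V x - G) / \<sigma>)"
    have "(\<integral>k. score \<epsilon> a b t (x, k) \<partial>?B)
        = a * (2 * V x - 1) * (?p * ?n1 + (1 - ?p) * ?n0) + y"
      using kp unfolding sc y_def[symmetric] by (simp add: algebra_simps)
    then show "(\<integral>k. score \<epsilon> a b t (x, k) \<partial>?B) = b / \<sigma> * (V x - G)"
      unfolding nm(1) by (simp add: y_def)
  qed
  also have "\<dots> = 0" using intV by (simp add: EV prob_space_P)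
  finally show "(\<integral>p. score \<epsilon> a b t p \<partial>Q) = 0" unfolding Q_def .
  have "(\<integral>p. (score \<epsilon> a b t p)\<^sup>2 \<partial>(P \<Otimes>\<^sub>M ?B)) = (\<integral>x. (\<integral>k. (score \<epsilon> a b t (x, k))\<^sup>2 \<partial>?B) \<partial>P)"
    by (rule PB.integral_fst'[OF int2, symmetric])
  also have "\<dots> = (\<integral>x. a\<^sup>2 * (exp \<epsilon> / (exp \<epsilon> - 1)\<^sup>2) + b\<^sup>2 / \<sigma>\<^sup>2 * ((1 - 2 * G) * V x + G\<^sup>2) \<partial>P)"
  proof (intro Bochner_Integration.integral_cong refl)
    fix x
    let ?n1 = "response_noise \<epsilon> True" and ?n0 = "response_noise \<epsilon> False" and ?p = "keep_prob \<epsilon>"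
    define w where "w = 2 * V x - 1"
    define y where "y = b * ((V x - G) / \<sigma>)"
    have w2: "w\<^sup>2 = 1" using V01[of x] by (auto simp: w_def)
    have y2: "y\<^sup>2 = b\<^sup>2 / \<sigma>\<^sup>2 * ((1 - 2 * G) * V x + G\<^sup>2)"
    proof -
      have "(V x - G)\<^sup>2 = (1 - 2 * G) * V x + G\<^sup>2"
        using V01[of x] by (auto simp: power2_eq_square algebra_simps)
      then show ?thesis by (simp add: y_def power_mult_distrib power_divide)
    qed
    have "(\<integral>k. (score \<epsilon> a b t (x, k))\<^sup>2 \<partial>?B) = ?p * (a * (w * ?n1) + y)\<^sup>2 + (1 - ?p) * (a * (w * ?n0) + y)\<^sup>2"
      using kp by (simp add: sc w_def y_def algebra_simps)
    also have "\<dots> = a\<^sup>2 * w\<^sup>2 * (?p * ?n1\<^sup>2 + (1 - ?p) * ?n0\<^sup>2)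
        + 2 * a * w * y * (?p * ?n1 + (1 - ?p) * ?n0) + y\<^sup>2"
      by (simp add: power2_eq_square algebra_simps)
    finally show "(\<integral>k. (score \<epsilon> a b t (x, k))\<^sup>2 \<partial>?B)
        = a\<^sup>2 * (exp \<epsilon> / (exp \<epsilon> - 1)\<^sup>2) + b\<^sup>2 / \<sigma>\<^sup>2 * ((1 - 2 * G) * V x + G\<^sup>2)"
      unfolding nm(1,2) w2 y2 by simp
  qed
  also have "\<dots> = a\<^sup>2 * (exp \<epsilon> / (exp \<epsilon> - 1)\<^sup>2) + b\<^sup>2 / \<sigma>\<^sup>2 * ((1 - 2 * G) * G + G\<^sup>2)"
    using intV by (simp add: EV prob_space_P)
  also have "(1 - 2 * G) * G + G\<^sup>2 = \<sigma>\<^sup>2" unfolding \<sigma>(2) by (simp add: power2_eq_square algebra_simps)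
  finally show "(\<integral>p. (score \<epsilon> a b t p)\<^sup>2 \<partial>Q) = a\<^sup>2 * (exp \<epsilon> / (exp \<epsilon> - 1)\<^sup>2) + b\<^sup>2"
    unfolding Q_def using \<sigma>(1) by simp
qed

lemma tail_variance_lower_bound:
  assumes "\<bar>t - t0\<bar> \<le> J / 4"
  shows "(J / 4)\<^sup>2 / var_stat \<mu> T \<theta>0 \<le> tail t \<theta>0 * (1 - tail t \<theta>0)"
proof -
  have "J / 4 \<le> slope t" using slope_lipschitz[of t] assms by linarith
  then have "(J / 4)\<^sup>2 \<le> (slope t)\<^sup>2" using abs_dev_pos by (intro power_mono) auto
  also note slope_variance_bound[of t]
  finally show ?thesis using var_pos by (simp add: pos_divide_le_eq)
qed

end

section \<open>Asymptotics of the two-stage estimator\<close>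

theorem proposition6:
  fixes \<mu> :: "'b measure"
    and T :: "'b \<Rightarrow> real"
    and \<theta>0 \<epsilon> :: real
    and M :: "nat \<Rightarrow> 'a measure"
    and That :: "nat \<Rightarrow> 'a \<Rightarrow> real"
    and X :: "nat \<Rightarrow> nat \<Rightarrow> 'a \<Rightarrow> 'b"
    and keep :: "nat \<Rightarrow> nat \<Rightarrow> 'a \<Rightarrow> bool"
  defines "\<delta>sq \<equiv> exp \<epsilon> / (exp \<epsilon> - 1)\<^sup>2"
    and "J \<equiv> abs_dev_stat \<mu> T \<theta>0"
    and "thetahat \<equiv> (\<lambda>n \<omega>. two_stage_estimator \<mu> T \<epsilon> n (That n \<omega>) (\<lambda>i. X n i \<omega>) (\<lambda>i. keep n i \<omega>))"
  assumes T_meas: "T \<in> borel_measurable \<mu>"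
    and theta0: "\<theta>0 \<in> interior (natural_space \<mu> T)"
    and var_pos: "\<And>\<theta>. \<theta> \<in> interior (natural_space \<mu> T) \<Longrightarrow> var_stat \<mu> T \<theta> > 0"
    and eps: "\<epsilon> > 0"
    and prob: "\<And>n. prob_space (M n)"
    and X_meas: "\<And>n i. i < n \<Longrightarrow> X n i \<in> M n \<rightarrow>\<^sub>M \<mu>"
    and X_distr: "\<And>n i. i < n \<Longrightarrow> distr (M n) \<mu> (X n i) = exp_family \<mu> T \<theta>0"
    and keep_meas: "\<And>n i. i < n \<Longrightarrow> keep n i \<in> M n \<rightarrow>\<^sub>M count_space UNIV"
    and keep_prob: "\<And>n i. i < n \<Longrightarrow>
      measure (M n) {\<omega> \<in> space (M n). keep n i \<omega>} = keep_prob \<epsilon>"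
    and X_keep_indep: "\<And>n i. i < n \<Longrightarrow>
      indep_var2 (M n) \<mu> (X n i) (count_space UNIV) (keep n i)"
    and pairs_indep: "\<And>n. prob_space.indep_vars (M n)
      (\<lambda>_. \<mu> \<Otimes>\<^sub>M count_space UNIV) (\<lambda>i \<omega>. (X n i \<omega>, keep n i \<omega>)) {..<n}"
    and That_indep: "\<And>n. indep_var2 (M n)
      borel (That n)
      (Pi\<^sub>M {..<n} (\<lambda>_. \<mu> \<Otimes>\<^sub>M count_space UNIV))
      (\<lambda>\<omega>. \<lambda>i\<in>{..<n}. (X n i \<omega>, keep n i \<omega>))"
    and That_conv: "conv_in_prob M That (mean_stat \<mu> T \<theta>0)"
  shows "\<exists>(G :: nat \<Rightarrow> 'a \<Rightarrow> real) (E1 :: nat \<Rightarrow> 'a \<Rightarrow> real) (E2 :: nat \<Rightarrow> 'a \<Rightarrow> real)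
            (R :: nat \<Rightarrow> 'a \<Rightarrow> ereal).
      (\<forall>n. G n \<in> borel_measurable (M n) \<and> E1 n \<in> borel_measurable (M n) \<and>
           E2 n \<in> borel_measurable (M n)) \<and>
      (\<forall>n. \<forall>\<omega>\<in>space (M n).
           G n \<omega> = tail_prob \<mu> T (That n \<omega>) \<theta>0 \<and> G n \<omega> \<in> {0..1}) \<and>
      (\<forall>n. \<forall>\<omega>\<in>space (M n).
           ereal (sqrt (real n)) * (thetahat n \<omega> - ereal \<theta>0)
             = ereal (2 * inverse J * (E1 n \<omega> + E2 n \<omega>)) + R n \<omega>) \<and>
      small_in_prob M R \<and>
      conv_in_distr M
        (\<lambda>n \<omega>. vector [E1 n \<omega>, 1 / sqrt (G n \<omega> * (1 - G n \<omega>)) * E2 n \<omega>] :: real ^ 2)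
        (mv_normal 0 (diag_matrix (vector [\<delta>sq, 1])))"
proof -
  interpret F: nondegenerate_exp_family \<mu> T \<theta>0
    by unfold_locales (use T_meas theta0 var_pos in auto)
  note T_meas [measurable] X_meas [measurable] keep_meas [measurable]
  have That_meas [measurable]: "That n \<in> borel_measurable (M n)" for n
    using That_indep by (simp add: indep_var2_def)
  note tail_meas [measurable] = F.tail_measurable[OF F.theta0_in]

  define V :: "nat \<Rightarrow> nat \<Rightarrow> 'a \<Rightarrow> real" where "V n i \<omega> = of_bool (T (X n i \<omega>) \<ge> That n \<omega>)" for n i \<omega>
  define \<xi> where "\<xi> n i \<omega> = response_noise \<epsilon> (keep n i \<omega>)" for n i \<omega>
  define G where "G n \<omega> = tail_prob \<mu> T (That n \<omega>) \<theta>0" for n \<omega>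
  define E1 where "E1 n \<omega> = (\<Sum>i<n. (2 * V n i \<omega> - 1) * \<xi> n i \<omega>) / sqrt (real n)" for n \<omega>
  define E2 where "E2 n \<omega> = (\<Sum>i<n. V n i \<omega> - G n \<omega>) / sqrt (real n)" for n \<omega>
  define zbar where "zbar n \<omega> = private_mean T \<epsilon> n (That n \<omega>) (\<lambda>i. X n i \<omega>) (\<lambda>i. keep n i \<omega>)" for n \<omega>
  define R where "R n \<omega> = ereal (sqrt (real n)) * (thetahat n \<omega> - ereal \<theta>0)
      - ereal (2 * inverse J * (E1 n \<omega> + E2 n \<omega>))" for n \<omega>
  define Y :: "nat \<Rightarrow> 'a \<Rightarrow> real ^ 2" where
    "Y n \<omega> = vector [E1 n \<omega>, 1 / sqrt (G n \<omega> * (1 - G n \<omega>)) * E2 n \<omega>]" for n \<omega>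
  define N where "N = mv_normal 0 (diag_matrix (vector [\<delta>sq, 1] :: real ^ 2))"

  have noise_meas [measurable]: "response_noise \<epsilon> \<in> borel_measurable (count_space UNIV)" by simp
  have V_meas [measurable]: "V n i \<in> borel_measurable (M n)" and \<xi>_meas [measurable]: "\<xi> n i \<in> borel_measurable (M n)"
    if "i < n" for n i
    using X_meas[OF that] keep_meas[OF that] unfolding V_def \<xi>_def of_bool_def by measurable
  have G_meas [measurable]: "G n \<in> borel_measurable (M n)" for n unfolding G_def by measurable
  have E1_meas [measurable]: "E1 n \<in> borel_measurable (M n)" for n unfolding E1_def by measurable
  have E2_meas [measurable]: "E2 n \<in> borel_measurable (M n)" for n unfolding E2_def by measurable
  have Y_meas [measurable]: "Y n \<in> borel_measurable (M n)" for n
    unfolding Y_def vector_2_eq_axis by measurable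
  have zbar_eq: "zbar n \<omega> = (\<Sum>i<n. V n i \<omega> + (2 * V n i \<omega> - 1) * \<xi> n i \<omega>) / real n" for n \<omega>
    by (simp add: zbar_def private_mean_def debias_rand_response[OF eps] V_def \<xi>_def)
  have zbar_meas [measurable]: "zbar n \<in> borel_measurable (M n)" for n unfolding zbar_eq by measurable
  have thetahat_eq: "thetahat n \<omega> = tail_inverse \<mu> T (zbar n \<omega>) (That n \<omega>)" for n \<omega>
    by (simp add: thetahat_def two_stage_estimator_def zbar_def)
  have thetahat_meas [measurable]: "thetahat n \<in> borel_measurable (M n)" for n
    using measurable_compose[OF measurable_Pair[OF zbar_meas[of n] That_meas[of n]] F.tail_inverse_measurable]
    by (simp add: ext[of "thetahat n", OF thetahat_eq])
  have R_meas [measurable]: "R n \<in> borel_measurable (M n)" for n unfolding R_def by measurable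

  have sum_eq: "E1 n \<omega> + E2 n \<omega> = sqrt (real n) * (zbar n \<omega> - G n \<omega>)" for n \<omega>
  proof (cases "n = 0")
    case False
    then have "sqrt (real n) * (zbar n \<omega> - G n \<omega>) = (real n * (zbar n \<omega> - G n \<omega>)) / sqrt (real n)"
      by (simp add: field_simps)
    also have "real n * (zbar n \<omega> - G n \<omega>)
        = (\<Sum>i<n. (2 * V n i \<omega> - 1) * \<xi> n i \<omega>) + (\<Sum>i<n. V n i \<omega> - G n \<omega>)"
      using False by (simp add: zbar_eq right_diff_distrib sum.distrib sum_subtractf)
    finally show ?thesis by (simp add: E1_def E2_def add_divide_distrib)
  qed (simp add: E1_def E2_def)

  define Q where "Q = exp_family \<mu> T \<theta>0 \<Otimes>\<^sub>M measure_pmf (bernoulli_pmf (keep_prob \<epsilon>))"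
  have pair_law: "distr (M n) (\<mu> \<Otimes>\<^sub>M count_space UNIV) (\<lambda>\<omega>. (X n i \<omega>, keep n i \<omega>)) = Q" if "i < n" for n i
    unfolding distr_Pair_indep_var2[OF prob X_keep_indep[OF that]] X_distr[OF that]
      distr_bernoulli[OF prob keep_meas[OF that] keep_prob[OF that]] Q_def ..
  interpret PB: pair_prob_space "exp_family \<mu> T \<theta>0" "measure_pmf (bernoulli_pmf (keep_prob \<epsilon>))" ..
  have prob_Q: "prob_space Q" unfolding Q_def by unfold_locales

  have J: "J > 0" unfolding J_def by (rule F.abs_dev_pos)
  \<comment> \<open>The slope is \<open>J / 2\<close> at the mean and 1-Lipschitz around it, hence at least \<open>J / 4\<close> on \<open>A\<close>.\<close>
  define \<kappa>0 where "\<kappa>0 = J / 4"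
  define m where "m = (J / 4)\<^sup>2 / var_stat \<mu> T \<theta>0"
  have m: "m > 0" using J var_pos[OF theta0] by (simp add: m_def)
  define A where "A = {t. \<bar>t - mean_stat \<mu> T \<theta>0\<bar> \<le> \<kappa>0}"
  have A_var: "m \<le> tail_prob \<mu> T t \<theta>0 * (1 - tail_prob \<mu> T t \<theta>0)" if "t \<in> A" for t
    using F.tail_variance_lower_bound[of t] that by (simp add: A_def m_def \<kappa>0_def J_def)
  have far: "(\<lambda>n. measure (M n) {\<omega> \<in> space (M n). \<kappa> < \<bar>That n \<omega> - mean_stat \<mu> T \<theta>0\<bar>}) \<longlonglongrightarrow> 0"
    if "\<kappa> > 0" for \<kappa>
    using That_conv that unfolding conv_in_prob_def small_in_prob_def by simp

  have d_pos: "0 < (vector [\<delta>sq, 1] :: real ^ 2) $ i" for i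
    using eps exhaust_2[of i] by (auto simp: \<delta>sq_def vector_2)
  have N_gauss: "N = gauss_measure (\<lambda>b. vector [\<delta>sq, 1] \<bullet> b)"
    unfolding N_def by (rule mv_normal_diag_eq_gauss[OF d_pos])
  have weights: "0 < vector [\<delta>sq, 1] \<bullet> b" if "b \<in> Basis" for b :: "real ^ 2"
    using that d_pos by (auto simp: Basis_vec_eq_range inner_axis)
  have prob_N: "prob_space N" unfolding N_gauss by (rule prob_space_gauss_measure[OF weights])
  have sets_N: "sets N = sets borel" by (simp add: N_gauss)

  have conv: "conv_in_distr M Y N"
  proof (rule levy_continuity_euclidean[OF prob Y_meas prob_N sets_N])
    fix u :: "real ^ 2"
    define C where "C = \<bar>u $ 1\<bar> * (exp \<epsilon> / (exp \<epsilon> - 1)) + \<bar>u $ 2\<bar> / sqrt m"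
    define v where "v = (u $ 1)\<^sup>2 * \<delta>sq + (u $ 2)\<^sup>2"
    have pos: "0 < tail_prob \<mu> T t \<theta>0 * (1 - tail_prob \<mu> T t \<theta>0)" if "t \<in> A" for t
      using A_var[OF that] m by linarith
    have inner: "u \<bullet> Y n \<omega>
        = (\<Sum>i<n. F.score \<epsilon> (u $ 1) (u $ 2) (That n \<omega>) (X n i \<omega>, keep n i \<omega>)) / sqrt (real n)" for n \<omega>
    proof -
      have "u \<bullet> Y n \<omega> = u $ 1 * E1 n \<omega> + u $ 2 * (1 / sqrt (G n \<omega> * (1 - G n \<omega>)) * E2 n \<omega>)"
        by (simp add: Y_def inner_vec_def sum_2 vector_2)
      also have "\<dots> = (\<Sum>i<n. u $ 1 * ((2 * V n i \<omega> - 1) * \<xi> n i \<omega>)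
          + u $ 2 * ((V n i \<omega> - G n \<omega>) / sqrt (G n \<omega> * (1 - G n \<omega>)))) / sqrt (real n)"
        by (simp add: E1_def E2_def sum.distrib sum_distrib_left sum_divide_distrib add_divide_distrib mult_ac)
      finally show ?thesis by (simp add: F.score_def V_def \<xi>_def G_def)
    qed
    have "(\<lambda>n. \<integral>\<omega>. iexp ((\<Sum>i<n. F.score \<epsilon> (u $ 1) (u $ 2) (That n \<omega>) (X n i \<omega>, keep n i \<omega>)) / sqrt (real n)) \<partial>M n)
        \<longlonglongrightarrow> complex_of_real (exp (- v / 2))"
    proof (rule mixture_clt_char[where D="\<lambda>n i \<omega>. (X n i \<omega>, keep n i \<omega>)" and A=A and C=C,
          OF prob pairs_indep pair_law prob_Q That_indep F.score_measurable])
      fix t p assume t: "t \<in> A"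
      show "\<bar>F.score \<epsilon> (u $ 1) (u $ 2) t p\<bar> \<le> C"
      proof (rule order_trans[OF F.score_moments(3)[OF eps pos[OF t]]])
        have "sqrt m \<le> sqrt (tail_prob \<mu> T t \<theta>0 * (1 - tail_prob \<mu> T t \<theta>0))"
          using A_var[OF t] by simp
        then show "\<bar>u $ 1\<bar> * (exp \<epsilon> / (exp \<epsilon> - 1))
            + \<bar>u $ 2\<bar> / sqrt (tail_prob \<mu> T t \<theta>0 * (1 - tail_prob \<mu> T t \<theta>0)) \<le> C"
          unfolding C_def using m by (intro add_left_mono divide_left_mono mult_pos_pos) auto
      qed
    next
      fix t assume t: "t \<in> A"
      show "(\<integral>p. F.score \<epsilon> (u $ 1) (u $ 2) t p \<partial>Q) = 0"
        unfolding Q_def by (rule F.score_moments(1)[OF eps pos[OF t]])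
      show "(\<integral>p. (F.score \<epsilon> (u $ 1) (u $ 2) t p)\<^sup>2 \<partial>Q) = v"
        unfolding Q_def v_def \<delta>sq_def by (rule F.score_moments(2)[OF eps pos[OF t]])
    next
      show "A \<in> sets borel" unfolding A_def by measurable
      show "0 \<le> v" using eps by (simp add: v_def \<delta>sq_def)
      show "0 \<le> C" using eps m by (simp add: C_def)
      show "(\<lambda>n. measure (M n) {\<omega> \<in> space (M n). That n \<omega> \<notin> A}) \<longlonglongrightarrow> 0"
        using far[of \<kappa>0] J by (simp add: A_def \<kappa>0_def not_le)
    qed
    moreover have "(\<integral>y. iexp (u \<bullet> y) \<partial>N) = complex_of_real (exp (- v / 2))"
    proof -
      have "(\<Sum>b\<in>Basis. (vector [\<delta>sq, 1] \<bullet> b) * (u \<bullet> b)\<^sup>2) = v"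
        unfolding Basis_vec_eq_range sum.reindex[OF inj_axis_1]
        by (simp add: inner_axis sum_2 vector_2 v_def mult.commute)
      with integral_iexp_gauss_measure[of "\<lambda>b. vector [\<delta>sq, 1] \<bullet> b" u, OF weights] show ?thesis
        unfolding N_gauss by simp
    qed
    ultimately show "(\<lambda>n. \<integral>\<omega>. iexp (u \<bullet> Y n \<omega>) \<partial>M n) \<longlonglongrightarrow> (\<integral>y. iexp (u \<bullet> y) \<partial>N)"
      by (simp only: inner)
  qed

  have small: "small_in_prob M R"
    unfolding small_in_prob_def
  proof (intro conjI allI impI R_meas)
    fix \<eta> :: real assume \<eta>: "\<eta> > 0"
    show "(\<lambda>n. measure (M n) {\<omega> \<in> space (M n). ereal \<eta> < \<bar>R n \<omega>\<bar>}) \<longlonglongrightarrow> 0"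
    proof (rule LIMSEQ_I)
      fix e :: real assume e: "e > 0"
      then have e2: "e / 2 > 0" by simp
      obtain B where B: "B \<ge> 0"
        and tight: "\<forall>\<^sub>F n in sequentially. measure (M n) {\<omega> \<in> space (M n). B < norm (Y n \<omega>)} < e / 2"
        using conv_in_distr_tight[OF conv prob prob_N sets_N e2] by blast
      obtain \<kappa> n0 where \<kappa>: "\<kappa> > 0" and expand: "\<And>n t p. n \<ge> n0 \<Longrightarrow> \<bar>t - mean_stat \<mu> T \<theta>0\<bar> \<le> \<kappa> \<Longrightarrow>
          \<bar>sqrt (real n) * (p - tail_prob \<mu> T t \<theta>0)\<bar> \<le> 2 * B \<Longrightarrow>
          \<bar>ereal (sqrt (real n)) * (tail_inverse \<mu> T p t - ereal \<theta>0)
            - ereal (2 * inverse J * (sqrt (real n) * (p - tail_prob \<mu> T t \<theta>0)))\<bar> \<le> ereal \<eta>"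
      proof (rule F.tail_inverse_expansion[of "2 * B" \<eta>])
        show "0 \<le> 2 * B" "0 < \<eta>" using B \<eta> by auto
      qed (rule that, auto simp: J_def)
      define \<kappa>1 where "\<kappa>1 = min \<kappa> \<kappa>0"
      have \<kappa>1: "\<kappa>1 > 0" using \<kappa> J by (simp add: \<kappa>1_def \<kappa>0_def)
      have close: "\<forall>\<^sub>F n in sequentially. measure (M n) {\<omega> \<in> space (M n). \<kappa>1 < \<bar>That n \<omega> - mean_stat \<mu> T \<theta>0\<bar>} < e / 2"
        by (rule order_tendstoD(2)[OF far[OF \<kappa>1] e2])
      have "\<forall>\<^sub>F n in sequentially. measure (M n) {\<omega> \<in> space (M n). ereal \<eta> < \<bar>R n \<omega>\<bar>} < e"
        using tight close eventually_ge_at_top[of n0]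
      proof eventually_elim
        case (elim n)
        interpret prob_space "M n" by (rule prob)
        \<comment> \<open>The second component of \<open>Y\<close> is standardized by a factor \<open>s \<le> 1\<close>, so a bound on it is also a
          bound on \<open>E2\<close>. The factor has to be positive, as a division by zero would hide \<open>E2\<close>.\<close>
        have good: "\<bar>R n \<omega>\<bar> \<le> ereal \<eta>"
          if Yn: "norm (Y n \<omega>) \<le> B" and Tn: "\<bar>That n \<omega> - mean_stat \<mu> T \<theta>0\<bar> \<le> \<kappa>1" for \<omega>
        proof -
          define s where "s = sqrt (G n \<omega> * (1 - G n \<omega>))"
          have "That n \<omega> \<in> A" using Tn by (simp add: A_def \<kappa>1_def)
          then have s0: "s > 0" using A_var[of "That n \<omega>"] m by (simp add: s_def G_def)
          have G01: "0 \<le> G n \<omega>" "G n \<omega> \<le> 1" using F.tail_range[OF F.theta0_in] by (auto simp: G_def)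
          then have s1: "s \<le> 1" by (simp add: s_def mult_le_one)
          have c1: "\<bar>E1 n \<omega>\<bar> \<le> B"
            using component_le_norm_cart[of "Y n \<omega>" 1] Yn by (simp add: Y_def vector_2)
          have c2: "\<bar>1 / s * E2 n \<omega>\<bar> \<le> B"
            using component_le_norm_cart[of "Y n \<omega>" 2] Yn by (simp add: Y_def vector_2 s_def)
          have "\<bar>E2 n \<omega>\<bar> = s * \<bar>1 / s * E2 n \<omega>\<bar>" using s0 by (simp add: abs_mult)
          also have "\<dots> \<le> 1 * B" using c2 s0 s1 by (intro mult_mono) auto
          finally have "\<bar>E1 n \<omega> + E2 n \<omega>\<bar> \<le> 2 * B" using c1 by linarith
          then show ?thesis
            using expand[of n "That n \<omega>" "zbar n \<omega>"] elim(3) Tn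
            unfolding R_def thetahat_eq sum_eq G_def[symmetric] by (simp add: \<kappa>1_def)
        qed
        have "measure (M n) {\<omega> \<in> space (M n). ereal \<eta> < \<bar>R n \<omega>\<bar>}
            \<le> measure (M n) ({\<omega> \<in> space (M n). B < norm (Y n \<omega>)}
                \<union> {\<omega> \<in> space (M n). \<kappa>1 < \<bar>That n \<omega> - mean_stat \<mu> T \<theta>0\<bar>})"
        proof (rule finite_measure_mono)
          show "{\<omega> \<in> space (M n). ereal \<eta> < \<bar>R n \<omega>\<bar>} \<subseteq> {\<omega> \<in> space (M n). B < norm (Y n \<omega>)}
                \<union> {\<omega> \<in> space (M n). \<kappa>1 < \<bar>That n \<omega> - mean_stat \<mu> T \<theta>0\<bar>}"
            using good by (auto simp: not_less[symmetric])
        qed measurable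
        also have "\<dots> \<le> measure (M n) {\<omega> \<in> space (M n). B < norm (Y n \<omega>)}
            + measure (M n) {\<omega> \<in> space (M n). \<kappa>1 < \<bar>That n \<omega> - mean_stat \<mu> T \<theta>0\<bar>}"
          by (rule measure_Un_le) measurable
        finally show ?case using elim(1,2) by linarith
      qed
      then show "\<exists>n0. \<forall>n\<ge>n0. norm (measure (M n) {\<omega> \<in> space (M n). ereal \<eta> < \<bar>R n \<omega>\<bar>} - 0) < e"
        by (simp add: eventually_sequentially)
    qed
  qed

  have G_range: "G n \<omega> \<in> {0..1}" for n \<omega>
    using F.tail_range[OF F.theta0_in] by (simp add: G_def)
  have decomp: "ereal (sqrt (real n)) * (thetahat n \<omega> - ereal \<theta>0)
      = ereal (2 * inverse J * (E1 n \<omega> + E2 n \<omega>)) + R n \<omega>" for n \<omega>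
    unfolding R_def by (cases "ereal (sqrt (real n)) * (thetahat n \<omega> - ereal \<theta>0)") auto
  show ?thesis
    by (rule exI[of _ G], rule exI[of _ E1], rule exI[of _ E2], rule exI[of _ R])
      (use G_meas E1_meas E2_meas G_range decomp small conv[unfolded Y_def[abs_def] N_def] in
        \<open>auto simp: G_def\<close>)
qed

end
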